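(* Let $X$ be a variety over a number field $K$. Let $B$ be a subgroup of $\operatorname{Br}X/\operatorname{Br}K$, and suppose that $B$ is prolific at a place $v$ of $K$. Then there is no Brauer–Manin obstruction to the existence of rational points on $X$ coming from $B$.
   Context: $\operatorname{Br}X:=H^2_{\text{ét}}(X,\mathbb{G}_m)$, and $\operatorname{Br}X/\operatorname{Br}K$ is the quotient by the image of $\operatorname{Br}K$. $\mathbf{A}_K$ is the ring of adèles of $K$. For a place $w$ of $K$, $\operatorname{inv}_w\colon\operatorname{Br}K_w\to\mathbb{Q}/\mathbb{Z}$ is the local invariant map, and $\mathcal{A}(P)=P^*\mathcal{A}\in\operatorname{Br}K_w$ for $\mathcal{A}\in\operatorname{Br}X$ and $P\in X(K_w)$. For an adelic point $(P_w)\in X(\mathbf{A}_K)$ the sum $\sum_w\operatorname{inv}_w\mathcal{A}(P_w)$ over all places $w$ of $K$ depends only on the class of $\mathcal{A}$ in $\operatorname{Br}X/\operatorname{Br}K$. Brauer–Manin obstruction. There is a Brauer–Manin obstruction to the existence of rational points on $X$ coming from $B$ if no adelic point $(P_w)\in X(\mathbf{A}_K)$ satisfies $\sum_w\operatorname{inv}_w\mathcal{A}(P_w)=0$ for all $\mathcal{A}\in B$. Definition (prolific). Suppose that $X(K_v)$ is non-empty, and let $P\in X(K_v)$. The pairing $(\operatorname{Br}X/\operatorname{Br}K)\times X(K_v)\to\mathbb{Q}/\mathbb{Z}$, $(\mathcal{A},Q)\mapsto\operatorname{inv}_v\mathcal{A}(Q)-\operatorname{inv}_v\mathcal{A}(P)$,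 is well defined. A subgroup $B\subseteq\operatorname{Br}X/\operatorname{Br}K$ is prolific at $v$ if the map $X(K_v)\to\operatorname{Hom}(B,\mathbb{Q}/\mathbb{Z})$ induced by this pairing is surjective. (This does not depend on the choice of $P$.)
   Formalization: X is assumed to have an adelic point: if X(A_K) is empty there is vacuously an obstruction (e.g. x²+y²+z²=0 over Q, B=0, v=3). That the sum of local invariants is finite and depends only on the class in Br X/Br K is assumed, as in the context. *)

theory Defs
  imports Complex_Main "HOL-Algebra.Algebra"
begin

text \<open>
  Schemes are handled through their functors of points on commutative rings whose carrier is a
  subset of a fixed type \<open>'r\<close>. This type plays the role of a universe: once it has at least the
  cardinality of the continuum, it accommodates all number fields, their completions and adele
  rings, all rings finitely presented over these, and all quotients used below. Similarly \<open>'i\<close> is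
  the universe in which sheaves of abelian groups take their values, and has to be large enough for
  injective resolutions to exist, and for injectivity in \<open>'i\<close> to be injectivity.

  Etale cohomology is the derived functor of global sections, computed on the big affine etale
  site. It agrees with cohomology on the small site. For an injective sheaf \<open>J\<close> on the big site,
  the restriction of \<open>J\<close> to the site localised at any scheme \<open>V\<close> is again injective, and its
  global sections over \<open>V\<close> are the natural transformations from \<open>V\<close> to \<open>J\<close>. So one injective
  resolution of \<open>\<bbbG>\<^sub>m\<close> on the big site computes the cohomology of all schemes, and pullback
  is composition.
\<close>


section \<open>Functors on rings\<close>

definition rhom :: "'r ring \<Rightarrow> 'r ring \<Rightarrow> ('r \<Rightarrow> 'r) set" where
  "rhom R S = {f \<in> ring_hom R S. f \<in> extensional (carrier R) \<and> cring R \<and> cring S}"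

record ('r, 'x) ringfun =
  pts :: "'r ring \<Rightarrow> 'x set"
  act :: "'r ring \<Rightarrow> 'r ring \<Rightarrow> ('r \<Rightarrow> 'r) \<Rightarrow> 'x \<Rightarrow> 'x"

definition is_functor :: "('r, 'x, 'z) ringfun_scheme \<Rightarrow> bool" where
  "is_functor V \<longleftrightarrow>
     (\<forall>R S. \<forall>f \<in> rhom R S. \<forall>x \<in> pts V R. act V R S f x \<in> pts V S) \<and>
     (\<forall>R. cring R \<longrightarrow> (\<forall>x \<in> pts V R. act V R R (\<lambda>a\<in>carrier R. a) x = x)) \<and>
     (\<forall>R S T. \<forall>f \<in> rhom R S. \<forall>g \<in> rhom S T. \<forall>x \<in> pts V R.
        act V R T (compose (carrier R) g f) x = act V S T g (act V R S f x))"

definition spec :: "'r ring \<Rightarrow> ('r, 'r \<Rightarrow> 'r) ringfun" where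
  "spec R = \<lparr>pts = rhom R, act = (\<lambda>S T f g. compose (carrier R) f g)\<rparr>"

text \<open>The compatibility condition ranges over all rings under both members of the cover. It is
  equivalent to compatibility on the tensor products.\<close>

definition is_sheaf ::
  "('r ring \<Rightarrow> ('r ring \<times> ('r \<Rightarrow> 'r)) set \<Rightarrow> bool) \<Rightarrow> ('r, 'x, 'z) ringfun_scheme \<Rightarrow> bool" where
  "is_sheaf cov V \<longleftrightarrow> is_functor V \<and>
     (\<forall>A \<U> s. cring A \<and> cov A \<U> \<and>
        (\<forall>(B, f) \<in> \<U>. s (B, f) \<in> pts V B) \<and>
        (\<forall>(B, f) \<in> \<U>. \<forall>(B', f') \<in> \<U>. \<forall>C. \<forall>g \<in> rhom B C. \<forall>g' \<in> rhom B' C.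
           compose (carrier A) g f = compose (carrier A) g' f' \<longrightarrow>
           act V B C g (s (B, f)) = act V B' C g' (s (B', f'))) \<longrightarrow>
        (\<exists>!x. x \<in> pts V A \<and> (\<forall>(B, f) \<in> \<U>. act V A B f x = s (B, f))))"


section \<open>Zariski and etale coverings\<close>

definition is_localization :: "'r ring \<Rightarrow> 'r \<Rightarrow> 'r ring \<Rightarrow> ('r \<Rightarrow> 'r) \<Rightarrow> bool" where
  "is_localization A a B f \<longleftrightarrow> a \<in> carrier A \<and> f \<in> rhom A B \<and> f a \<in> Units B \<and>
     (\<forall>C. \<forall>g \<in> rhom A C. g a \<in> Units C \<longrightarrow>
        (\<exists>!h. h \<in> rhom B C \<and> compose (carrier A) h f = g))"

definition zariski_cover :: "'r ring \<Rightarrow> ('r ring \<times> ('r \<Rightarrow> 'r)) set \<Rightarrow> bool" where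
  "zariski_cover A \<U> \<longleftrightarrow> finite \<U> \<and>
     (\<exists>a. (\<forall>(B, f) \<in> \<U>. is_localization A (a (B, f)) B f) \<and> genideal A (a ` \<U>) = carrier A)"

text \<open>Expressions for polynomials with coefficients in \<open>'r\<close>.\<close>

datatype 'r pexp = Coeff 'r | Indet nat | Plus "'r pexp" "'r pexp" | Times "'r pexp" "'r pexp"

primrec pexp_over :: "'r set \<Rightarrow> nat \<Rightarrow> 'r pexp \<Rightarrow> bool" where
  "pexp_over A n (Coeff a) \<longleftrightarrow> a \<in> A"
| "pexp_over A n (Indet i) \<longleftrightarrow> i < n"
| "pexp_over A n (Plus p q) \<longleftrightarrow> pexp_over A n p \<and> pexp_over A n q"
| "pexp_over A n (Times p q) \<longleftrightarrow> pexp_over A n p \<and> pexp_over A n q"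

primrec peval :: "'r ring \<Rightarrow> ('r \<Rightarrow> 'r) \<Rightarrow> (nat \<Rightarrow> 'r) \<Rightarrow> 'r pexp \<Rightarrow> 'r" where
  "peval B f b (Coeff a) = f a"
| "peval B f b (Indet i) = b i"
| "peval B f b (Plus p q) = peval B f b p \<oplus>\<^bsub>B\<^esub> peval B f b q"
| "peval B f b (Times p q) = peval B f b p \<otimes>\<^bsub>B\<^esub> peval B f b q"

text \<open>\<open>B\<close> is \<open>A[x\<^sub>0, \<dots>, x\<^sub>n\<^sub>-\<^sub>1]\<close> modulo the equations in \<open>E\<close>, expressed by the universal property
  of this quotient.\<close>

definition finitely_presented :: "'r ring \<Rightarrow> 'r ring \<Rightarrow> ('r \<Rightarrow> 'r) \<Rightarrow> bool" where
  "finitely_presented A B f \<longleftrightarrow> f \<in> rhom A B \<and>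
     (\<exists>n E b. finite E \<and> (\<forall>(p, q) \<in> E. pexp_over (carrier A) n p \<and> pexp_over (carrier A) n q) \<and>
        b \<in> {..<n} \<rightarrow> carrier B \<and> (\<forall>(p, q) \<in> E. peval B f b p = peval B f b q) \<and>
        (\<forall>C. \<forall>u \<in> rhom A C. \<forall>c \<in> {..<n} \<rightarrow> carrier C.
           (\<forall>(p, q) \<in> E. peval C u c p = peval C u c q) \<longrightarrow>
           (\<exists>!h. h \<in> rhom B C \<and> compose (carrier A) h f = u \<and> (\<forall>i<n. h (b i) = c i))))"

text \<open>Infinitesimal lifting along surjections \<open>C \<rightarrow> D\<close> with square-zero kernel.\<close>

definition formally_etale :: "'r ring \<Rightarrow> 'r ring \<Rightarrow> ('r \<Rightarrow> 'r) \<Rightarrow> bool" where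
  "formally_etale A B f \<longleftrightarrow> f \<in> rhom A B \<and>
     (\<forall>C D. \<forall>q \<in> rhom C D. \<forall>u \<in> rhom A C. \<forall>g \<in> rhom B D.
        q ` carrier C = carrier D \<and>
        (\<forall>x \<in> a_kernel C D q. \<forall>y \<in> a_kernel C D q. x \<otimes>\<^bsub>C\<^esub> y = \<zero>\<^bsub>C\<^esub>) \<and>
        compose (carrier A) q u = compose (carrier A) g f \<longrightarrow>
        (\<exists>!h. h \<in> rhom B C \<and> compose (carrier A) h f = u \<and> compose (carrier B) q h = g))"

definition etale :: "'r ring \<Rightarrow> 'r ring \<Rightarrow> ('r \<Rightarrow> 'r) \<Rightarrow> bool" where
  "etale A B f \<longleftrightarrow> finitely_presented A B f \<and> formally_etale A B f"

definition etale_cover :: "'r ring \<Rightarrow> ('r ring \<times> ('r \<Rightarrow> 'r)) set \<Rightarrow> bool" where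
  "etale_cover A \<U> \<longleftrightarrow> finite \<U> \<and> (\<forall>(B, f) \<in> \<U>. etale A B f) \<and>
     (\<forall>\<pp>. primeideal \<pp> A \<longrightarrow>
        (\<exists>(B, f) \<in> \<U>. \<exists>\<qq>. primeideal \<qq> B \<and> \<pp> = {a \<in> carrier A. f a \<in> \<qq>}))"


section \<open>Varieties\<close>

record ('r, 'x) kscheme = "('r, 'x) ringfun" +
  str :: "'r ring \<Rightarrow> 'x \<Rightarrow> 'r \<Rightarrow> 'r"

definition nat_trans ::
  "('r, 'y, 'z) ringfun_scheme \<Rightarrow> ('r, 'x, 'w) ringfun_scheme \<Rightarrow> ('r ring \<Rightarrow> 'y \<Rightarrow> 'x) \<Rightarrow> bool" where
  "nat_trans Y V t \<longleftrightarrow>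
     (\<forall>R. cring R \<longrightarrow> (\<forall>y \<in> pts Y R. t R y \<in> pts V R)) \<and>
     (\<forall>R S. \<forall>f \<in> rhom R S. \<forall>y \<in> pts Y R. t S (act Y R S f y) = act V R S f (t R y))"

definition yoneda :: "('r, 'x, 'z) ringfun_scheme \<Rightarrow> 'r ring \<Rightarrow> 'x \<Rightarrow> 'r ring \<Rightarrow> ('r \<Rightarrow> 'r) \<Rightarrow> 'x" where
  "yoneda V L P = (\<lambda>R g. act V L R g P)"

definition open_subfunctor :: "('r, 'x, 'z) ringfun_scheme \<Rightarrow> ('r ring \<Rightarrow> 'x set) \<Rightarrow> bool" where
  "open_subfunctor V U \<longleftrightarrow> (\<forall>A. cring A \<longrightarrow> U A \<subseteq> pts V A \<and>
     (\<forall>x \<in> pts V A. \<exists>J. ideal J A \<and>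
        (\<forall>B. \<forall>f \<in> rhom A B. act V A B f x \<in> U B \<longleftrightarrow> genideal B (f ` J) = carrier B)))"

text \<open>\<open>U\<close> is represented by a ring that is finitely generated as a \<open>K\<close>-algebra.\<close>

definition affine_finite_type :: "'r ring \<Rightarrow> ('r, 'x) kscheme \<Rightarrow> ('r ring \<Rightarrow> 'x set) \<Rightarrow> bool" where
  "affine_finite_type K V U \<longleftrightarrow> (\<exists>R u. cring R \<and> u \<in> U R \<and>
     (\<forall>A. cring A \<longrightarrow> bij_betw (\<lambda>g. act V R A g u) (rhom R A) (U A)) \<and>
     (\<exists>S. finite S \<and> S \<subseteq> carrier R \<and> generate_ring R (str V R u ` carrier K \<union> S) = carrier R))"

text \<open>The diagonal is a closed immersion.\<close>

definition separated :: "('r, 'x) kscheme \<Rightarrow> bool" where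
  "separated V \<longleftrightarrow> (\<forall>A. cring A \<longrightarrow> (\<forall>x \<in> pts V A. \<forall>y \<in> pts V A. str V A x = str V A y \<longrightarrow>
     (\<exists>J. ideal J A \<and> (\<forall>B. \<forall>f \<in> rhom A B.
        act V A B f x = act V A B f y \<longleftrightarrow> f ` J \<subseteq> {\<zero>\<^bsub>B\<^esub>}))))"

text \<open>A variety is a separated scheme of finite type over a field. A family of open subfunctors
  covers \<open>V\<close> if it does so on field-valued points.\<close>

definition variety :: "'r ring \<Rightarrow> ('r, 'x) kscheme \<Rightarrow> bool" where
  "variety K V \<longleftrightarrow> field K \<and> is_sheaf zariski_cover V \<and> nat_trans V (spec K) (str V) \<and> separated V \<and>
     (\<exists>\<U>. finite \<U> \<and> (\<forall>U \<in> \<U>. open_subfunctor V U \<and> affine_finite_type K V U) \<and>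
        (\<forall>L. field L \<longrightarrow> pts V L = (\<Union>U \<in> \<U>. U L)))"

text \<open>\<open>L\<close>-valued points over \<open>K\<close>, for a \<open>K\<close>-algebra \<open>L\<close> with structure map \<open>j\<close>.\<close>

definition kpoints :: "('r, 'x) kscheme \<Rightarrow> 'r ring \<Rightarrow> ('r \<Rightarrow> 'r) \<Rightarrow> 'x set" where
  "kpoints V L j = {P \<in> pts V L. str V L P = j}"


section \<open>Etale cohomology of the multiplicative group\<close>

text \<open>Abelian groups are written multiplicatively throughout.\<close>

record ('r, 'i) absheaf =
  grp :: "'r ring \<Rightarrow> 'i monoid"
  res :: "'r ring \<Rightarrow> 'r ring \<Rightarrow> ('r \<Rightarrow> 'r) \<Rightarrow> 'i \<Rightarrow> 'i"

definition underlying :: "('r, 'i) absheaf \<Rightarrow> ('r, 'i) ringfun" where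
  "underlying F = \<lparr>pts = (\<lambda>R. carrier (grp F R)), act = res F\<rparr>"

definition is_absheaf :: "('r, 'i) absheaf \<Rightarrow> bool" where
  "is_absheaf F \<longleftrightarrow> (\<forall>R. cring R \<longrightarrow> comm_group (grp F R)) \<and>
     (\<forall>R S. \<forall>f \<in> rhom R S. res F R S f \<in> hom (grp F R) (grp F S)) \<and>
     is_sheaf etale_cover (underlying F)"

definition Gm :: "('r, 'r) absheaf" where
  "Gm = \<lparr>grp = units_of, res = (\<lambda>R S f. f)\<rparr>"

definition absheaf_hom ::
  "('r, 'i) absheaf \<Rightarrow> ('r, 'j) absheaf \<Rightarrow> ('r ring \<Rightarrow> 'i \<Rightarrow> 'j) \<Rightarrow> bool" where
  "absheaf_hom F G t \<longleftrightarrow> nat_trans (underlying F) (underlying G) t \<and>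
     (\<forall>R. cring R \<longrightarrow> t R \<in> hom (grp F R) (grp G R))"

definition absheaf_mono ::
  "('r, 'i) absheaf \<Rightarrow> ('r, 'j) absheaf \<Rightarrow> ('r ring \<Rightarrow> 'i \<Rightarrow> 'j) \<Rightarrow> bool" where
  "absheaf_mono F G t \<longleftrightarrow> absheaf_hom F G t \<and> (\<forall>R. cring R \<longrightarrow> inj_on (t R) (carrier (grp F R)))"

definition absheaf_exact ::
  "('r, 'i) absheaf \<Rightarrow> ('r ring \<Rightarrow> 'i \<Rightarrow> 'j) \<Rightarrow> ('r, 'j) absheaf \<Rightarrow> ('r ring \<Rightarrow> 'j \<Rightarrow> 'k) \<Rightarrow>
     ('r, 'k) absheaf \<Rightarrow> bool" where
  "absheaf_exact F t G u H \<longleftrightarrow> absheaf_hom F G t \<and> absheaf_hom G H u \<and>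
     (\<forall>R. cring R \<longrightarrow> (\<forall>x \<in> carrier (grp F R). u R (t R x) = \<one>\<^bsub>grp H R\<^esub>) \<and>
        (\<forall>y \<in> carrier (grp G R). u R y = \<one>\<^bsub>grp H R\<^esub> \<longrightarrow>
           (\<exists>\<U>. etale_cover R \<U> \<and>
              (\<forall>(S, f) \<in> \<U>. res G R S f y \<in> t S ` carrier (grp F S)))))"

definition injective_absheaf :: "('r, 'i) absheaf \<Rightarrow> bool" where
  "injective_absheaf J \<longleftrightarrow> is_absheaf J \<and>
     (\<forall>(F :: ('r, 'i) absheaf) (G :: ('r, 'i) absheaf) m t.
        is_absheaf F \<and> is_absheaf G \<and> absheaf_mono F G m \<and> absheaf_hom F J t \<longrightarrow>
        (\<exists>u. absheaf_hom G J u \<and> (\<forall>R. cring R \<longrightarrow> (\<forall>x \<in> carrier (grp F R). u R (m R x) = t R x))))"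

record ('r, 'i) resolution =
  obj :: "nat \<Rightarrow> ('r, 'i) absheaf"
  aug :: "'r ring \<Rightarrow> 'r \<Rightarrow> 'i"
  diff :: "nat \<Rightarrow> 'r ring \<Rightarrow> 'i \<Rightarrow> 'i"

definition Gm_injective_resolution :: "('r, 'i) resolution \<Rightarrow> bool" where
  "Gm_injective_resolution I \<longleftrightarrow> (\<forall>n. injective_absheaf (obj I n)) \<and>
     absheaf_mono Gm (obj I 0) (aug I) \<and>
     absheaf_exact Gm (aug I) (obj I 0) (diff I 0) (obj I 1) \<and>
     (\<forall>n. absheaf_exact (obj I n) (diff I n) (obj I (n + 1)) (diff I (n + 1)) (obj I (n + 2)))"

text \<open>Functions on the points of \<open>V\<close>, normalised to be undefined elsewhere so that equality of
  sections is equality of functions.\<close>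

definition on_points ::
  "('r, 'x, 'z) ringfun_scheme \<Rightarrow> ('r ring \<Rightarrow> 'x \<Rightarrow> 'i) \<Rightarrow> 'r ring \<Rightarrow> 'x \<Rightarrow> 'i" where
  "on_points V s = (\<lambda>R x. if cring R \<and> x \<in> pts V R then s R x else undefined)"

definition sections ::
  "('r, 'x, 'z) ringfun_scheme \<Rightarrow> ('r, 'i) absheaf \<Rightarrow> ('r ring \<Rightarrow> 'x \<Rightarrow> 'i) monoid" where
  "sections V F =
     \<lparr>carrier = {s. nat_trans V (underlying F) s \<and> on_points V s = s},
      monoid.mult = (\<lambda>s t. on_points V (\<lambda>R x. s R x \<otimes>\<^bsub>grp F R\<^esub> t R x)),
      one = on_points V (\<lambda>R x. \<one>\<^bsub>grp F R\<^esub>)\<rparr>"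

definition section_diff ::
  "('r, 'i) resolution \<Rightarrow> nat \<Rightarrow> ('r, 'x, 'z) ringfun_scheme \<Rightarrow>
     ('r ring \<Rightarrow> 'x \<Rightarrow> 'i) \<Rightarrow> 'r ring \<Rightarrow> 'x \<Rightarrow> 'i" where
  "section_diff I n V s = on_points V (\<lambda>R x. diff I n R (s R x))"

definition cocycles ::
  "('r, 'i) resolution \<Rightarrow> nat \<Rightarrow> ('r, 'x, 'z) ringfun_scheme \<Rightarrow> ('r ring \<Rightarrow> 'x \<Rightarrow> 'i) monoid" where
  "cocycles I n V = (sections V (obj I n))
     \<lparr>carrier := kernel (sections V (obj I n)) (sections V (obj I (n + 1))) (section_diff I n V)\<rparr>"

definition coboundaries ::
  "('r, 'i) resolution \<Rightarrow> nat \<Rightarrow> ('r, 'x, 'z) ringfun_scheme \<Rightarrow> ('r ring \<Rightarrow> 'x \<Rightarrow> 'i) set" where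
  "coboundaries I n V = (case n of 0 \<Rightarrow> {\<one>\<^bsub>sections V (obj I 0)\<^esub>}
     | Suc m \<Rightarrow> section_diff I m V ` carrier (sections V (obj I m)))"

definition cohomology ::
  "('r, 'i) resolution \<Rightarrow> nat \<Rightarrow> ('r, 'x, 'z) ringfun_scheme \<Rightarrow> ('r ring \<Rightarrow> 'x \<Rightarrow> 'i) set monoid" where
  "cohomology I n V = cocycles I n V Mod coboundaries I n V"

text \<open>The coset of the pulled back cocycles.\<close>

definition pullback ::
  "('r, 'i) resolution \<Rightarrow> nat \<Rightarrow> ('r, 'y, 'z) ringfun_scheme \<Rightarrow> ('r ring \<Rightarrow> 'y \<Rightarrow> 'x) \<Rightarrow>
     ('r ring \<Rightarrow> 'x \<Rightarrow> 'i) set \<Rightarrow> ('r ring \<Rightarrow> 'y \<Rightarrow> 'i) set" where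
  "pullback I n Y t c =
     coboundaries I n Y <#>\<^bsub>cocycles I n Y\<^esub> (\<lambda>s. on_points Y (\<lambda>R y. s R (t R y))) ` c"

definition Br ::
  "('r, 'i) resolution \<Rightarrow> ('r, 'x, 'z) ringfun_scheme \<Rightarrow> ('r ring \<Rightarrow> 'x \<Rightarrow> 'i) set monoid" where
  "Br I V = cohomology I 2 V"

definition Br_const ::
  "('r, 'i) resolution \<Rightarrow> 'r ring \<Rightarrow> ('r, 'x) kscheme \<Rightarrow> ('r ring \<Rightarrow> 'x \<Rightarrow> 'i) set set" where
  "Br_const I K V = pullback I 2 V (str V) ` carrier (Br I (spec K))"

definition Br_mod_const ::
  "('r, 'i) resolution \<Rightarrow> 'r ring \<Rightarrow> ('r, 'x) kscheme \<Rightarrow> ('r ring \<Rightarrow> 'x \<Rightarrow> 'i) set set monoid" where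
  "Br_mod_const I K V = Br I V Mod Br_const I K V"

definition Br_eval ::
  "('r, 'i) resolution \<Rightarrow> ('r, 'x) kscheme \<Rightarrow> 'r ring \<Rightarrow>
     ('r ring \<Rightarrow> 'x \<Rightarrow> 'i) set \<Rightarrow> 'x \<Rightarrow> ('r ring \<Rightarrow> ('r \<Rightarrow> 'r) \<Rightarrow> 'i) set" where
  "Br_eval I V L \<A> P = pullback I 2 (spec L) (yoneda V L P) \<A>"


section \<open>Number fields, places, completions and adeles\<close>

definition number_field :: "'r ring \<Rightarrow> bool" where
  "number_field K \<longleftrightarrow> field K \<and> (\<forall>n::nat. n > 0 \<longrightarrow> add_pow K n \<one>\<^bsub>K\<^esub> \<noteq> \<zero>\<^bsub>K\<^esub>) \<and>
     ring.finite_dimension K (generate_field K {}) (carrier K)"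

definition absolute_value :: "'r ring \<Rightarrow> ('r \<Rightarrow> real) \<Rightarrow> bool" where
  "absolute_value K \<nu> \<longleftrightarrow> \<nu> \<in> extensional (carrier K) \<and>
     (\<forall>x \<in> carrier K. \<nu> x \<ge> 0 \<and> (\<nu> x = 0 \<longleftrightarrow> x = \<zero>\<^bsub>K\<^esub>)) \<and>
     (\<forall>x \<in> carrier K. \<forall>y \<in> carrier K. \<nu> (x \<otimes>\<^bsub>K\<^esub> y) = \<nu> x * \<nu> y \<and> \<nu> (x \<oplus>\<^bsub>K\<^esub> y) \<le> \<nu> x + \<nu> y)"

definition nonarchimedean :: "'r ring \<Rightarrow> ('r \<Rightarrow> real) \<Rightarrow> bool" where
  "nonarchimedean K \<nu> \<longleftrightarrow> (\<forall>x \<in> carrier K. \<forall>y \<in> carrier K. \<nu> (x \<oplus>\<^bsub>K\<^esub> y) \<le> max (\<nu> x) (\<nu> y))"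

text \<open>Two absolute values are equivalent if they define the same topology, that is, if they have
  the same open unit ball. A place is an equivalence class of nontrivial absolute values.\<close>

type_synonym 'r place = "('r \<Rightarrow> real) set"

definition places :: "'r ring \<Rightarrow> 'r place set" where
  "places K = {w. \<exists>\<nu>. absolute_value K \<nu> \<and> (\<exists>x \<in> carrier K. x \<noteq> \<zero>\<^bsub>K\<^esub> \<and> \<nu> x \<noteq> 1) \<and>
     w = {\<nu>'. absolute_value K \<nu>' \<and> (\<forall>x \<in> carrier K. \<nu>' x < 1 \<longleftrightarrow> \<nu> x < 1)}}"

definition is_completion ::
  "'r ring \<Rightarrow> 'r place \<Rightarrow> 'r ring \<Rightarrow> ('r \<Rightarrow> 'r) \<Rightarrow> ('r \<Rightarrow> real) \<Rightarrow> bool" where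
  "is_completion K w L j \<nu> \<longleftrightarrow> field L \<and> j \<in> rhom K L \<and> absolute_value L \<nu> \<and>
     (\<lambda>x\<in>carrier K. \<nu> (j x)) \<in> w \<and>
     (\<forall>x \<in> carrier L. \<forall>\<epsilon>>0. \<exists>y \<in> carrier K. \<nu> (x \<ominus>\<^bsub>L\<^esub> j y) < \<epsilon>) \<and>
     (\<forall>s :: nat \<Rightarrow> 'r. range s \<subseteq> carrier L \<and>
        (\<forall>\<epsilon>>0. \<exists>N. \<forall>m\<ge>N. \<forall>n\<ge>N. \<nu> (s m \<ominus>\<^bsub>L\<^esub> s n) < \<epsilon>) \<longrightarrow>
        (\<exists>x \<in> carrier L. (\<lambda>n. \<nu> (s n \<ominus>\<^bsub>L\<^esub> x)) \<longlonglongrightarrow> 0))"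

text \<open>Models in \<open>'r\<close> of the completions of \<open>K\<close> (with the embedding of \<open>K\<close> and an absolute value)
  and of the adele ring (with its coordinate functions).\<close>

record 'r completions =
  cfield :: "'r place \<Rightarrow> 'r ring"
  cemb :: "'r place \<Rightarrow> 'r \<Rightarrow> 'r"
  cabs :: "'r place \<Rightarrow> 'r \<Rightarrow> real"
  adeles :: "'r ring"
  coord :: "'r \<Rightarrow> 'r place \<Rightarrow> 'r"

definition restricted_product :: "'r ring \<Rightarrow> 'r completions \<Rightarrow> ('r place \<Rightarrow> 'r) ring" where
  "restricted_product K D =
     \<lparr>carrier = {a \<in> (\<Pi>\<^sub>E w \<in> places K. carrier (cfield D w)).
        finite {w \<in> places K. nonarchimedean (cfield D w) (cabs D w) \<and> cabs D w (a w) > 1}},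
      monoid.mult = (\<lambda>a b. \<lambda>w\<in>places K. a w \<otimes>\<^bsub>cfield D w\<^esub> b w),
      one = (\<lambda>w\<in>places K. \<one>\<^bsub>cfield D w\<^esub>),
      ring.zero = (\<lambda>w\<in>places K. \<zero>\<^bsub>cfield D w\<^esub>),
      ring.add = (\<lambda>a b. \<lambda>w\<in>places K. a w \<oplus>\<^bsub>cfield D w\<^esub> b w)\<rparr>"

definition completions_of :: "'r ring \<Rightarrow> 'r completions \<Rightarrow> bool" where
  "completions_of K D \<longleftrightarrow>
     (\<forall>w \<in> places K. is_completion K w (cfield D w) (cemb D w) (cabs D w)) \<and>
     cring (adeles D) \<and> coord D \<in> ring_iso (adeles D) (restricted_product K D)"

definition local_points :: "('r, 'x) kscheme \<Rightarrow> 'r completions \<Rightarrow> 'r place \<Rightarrow> 'x set" where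
  "local_points V D w = kpoints V (cfield D w) (cemb D w)"

text \<open>Points over the adele ring, viewed as a \<open>K\<close>-algebra through the diagonal embedding.\<close>

definition adelic_points :: "'r ring \<Rightarrow> ('r, 'x) kscheme \<Rightarrow> 'r completions \<Rightarrow> 'x set" where
  "adelic_points K V D = {P \<in> pts V (adeles D).
     \<forall>x \<in> carrier K. coord D (str V (adeles D) P x) = (\<lambda>w\<in>places K. cemb D w x)}"

definition component :: "('r, 'x) kscheme \<Rightarrow> 'r completions \<Rightarrow> 'x \<Rightarrow> 'r place \<Rightarrow> 'x" where
  "component V D P w = act V (adeles D) (cfield D w) (\<lambda>a\<in>carrier (adeles D). coord D a w) P"


section \<open>Local invariants\<close>

definition rat_additive :: "rat monoid" where
  "rat_additive = \<lparr>carrier = UNIV, monoid.mult = (+), one = 0\<rparr>"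

definition QZ :: "rat set monoid" where
  "QZ = rat_additive Mod \<int>"

definition QZ_of :: "rat \<Rightarrow> rat set" where
  "QZ_of q = \<int> #>\<^bsub>rat_additive\<^esub> q"

text \<open>
  \<open>\<alpha> \<in> Br k\<close> is the class of the cyclic algebra \<open>(L/k, \<sigma>, c)\<close>, where \<open>j : k \<rightarrow> L\<close> is cyclic of
  degree \<open>n\<close> with generator \<open>\<sigma>\<close> and \<open>c \<in> k\<^sup>*\<close>. That is, \<open>\<alpha>\<close> is the image of the class of the
  2-cocycle \<open>(\<sigma>\<^sup>i, \<sigma>\<^sup>l) \<mapsto> c\<close> if \<open>i + l \<ge> n\<close>, and \<open>1\<close> otherwise \<open>(0 \<le> i, l < n)\<close>, under
  \<open>H\<^sup>2(Gal(L/k), L\<^sup>*) \<rightarrow> H\<^sup>2(k, \<bbbG>\<^sub>m)\<close>. The cochains \<open>b\<close> and \<open>a\<close> bound the difference of the two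
  cocycles in the total complex of the double complex \<open>C\<^sup>p(Gal(L/k), I\<^sup>q(L))\<close>, with total
  differential \<open>\<delta> + (-1)\<^sup>p d\<close>.
\<close>

definition cyclic_class ::
  "('r, 'i) resolution \<Rightarrow> 'r ring \<Rightarrow> 'r ring \<Rightarrow> ('r \<Rightarrow> 'r) \<Rightarrow> ('r \<Rightarrow> 'r) \<Rightarrow> nat \<Rightarrow> 'r \<Rightarrow>
     ('r ring \<Rightarrow> ('r \<Rightarrow> 'r) \<Rightarrow> 'i) set \<Rightarrow> bool" where
  "cyclic_class I k L j \<sigma> n c \<alpha> \<longleftrightarrow> \<alpha> \<in> carrier (Br I (spec k)) \<and>
     (let g = (\<lambda>q i. res (obj I q) L L (\<lambda>x\<in>carrier L. (\<sigma> ^^ i) x)) in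
      \<exists>s \<in> \<alpha>. \<exists>b \<in> {..<n} \<rightarrow> carrier (grp (obj I 0) L). \<exists>a \<in> carrier (grp (obj I 1) L).
        (\<forall>i<n. \<forall>l<n. aug I L (if i + l \<ge> n then j c else \<one>\<^bsub>L\<^esub>) =
           g 0 i (b l) \<otimes>\<^bsub>grp (obj I 0) L\<^esub> inv\<^bsub>grp (obj I 0) L\<^esub> (b ((i + l) mod n))
             \<otimes>\<^bsub>grp (obj I 0) L\<^esub> b i) \<and>
        (\<forall>i<n. diff I 0 L (b i) = inv\<^bsub>grp (obj I 1) L\<^esub> (g 1 i a \<otimes>\<^bsub>grp (obj I 1) L\<^esub>
           inv\<^bsub>grp (obj I 1) L\<^esub> a)) \<and>
        diff I 1 L a = s L j)"

definition residue_cardinality :: "'r ring \<Rightarrow> ('r \<Rightarrow> real) \<Rightarrow> nat" where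
  "residue_cardinality k \<nu> =
     card (carrier ((k\<lparr>carrier := {x \<in> carrier k. \<nu> x \<le> 1}\<rparr>) Quot {x \<in> carrier k. \<nu> x < 1}))"

definition uniformizer :: "'r ring \<Rightarrow> ('r \<Rightarrow> real) \<Rightarrow> 'r \<Rightarrow> bool" where
  "uniformizer k \<nu> \<pi> \<longleftrightarrow> \<pi> \<in> carrier k \<and> \<pi> \<noteq> \<zero>\<^bsub>k\<^esub> \<and> \<nu> \<pi> < 1 \<and>
     (\<forall>x \<in> carrier k. \<nu> x < 1 \<longrightarrow> \<nu> x \<le> \<nu> \<pi>)"

definition extension_automorphism ::
  "'r ring \<Rightarrow> 'r ring \<Rightarrow> ('r \<Rightarrow> 'r) \<Rightarrow> nat \<Rightarrow> ('r \<Rightarrow> 'r) \<Rightarrow> bool" where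
  "extension_automorphism k L j n \<sigma> \<longleftrightarrow> field L \<and> j \<in> rhom k L \<and>
     ring.dimension L n (j ` carrier k) (carrier L) \<and>
     \<sigma> \<in> rhom L L \<and> bij_betw \<sigma> (carrier L) (carrier L) \<and> (\<forall>x \<in> carrier k. \<sigma> (j x) = j x)"

text \<open>For complete discretely valued fields with finite residue field, an extension is unramified
  if and only if the value groups coincide.\<close>

definition unramified_frobenius ::
  "'r ring \<Rightarrow> ('r \<Rightarrow> real) \<Rightarrow> 'r ring \<Rightarrow> ('r \<Rightarrow> 'r) \<Rightarrow> nat \<Rightarrow> ('r \<Rightarrow> 'r) \<Rightarrow> bool" where
  "unramified_frobenius k \<nu> L j n \<sigma> \<longleftrightarrow> extension_automorphism k L j n \<sigma> \<and>
     (\<exists>\<mu>. absolute_value L \<mu> \<and> (\<forall>x \<in> carrier k. \<mu> (j x) = \<nu> x) \<and>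
        \<mu> ` carrier L = \<nu> ` carrier k \<and>
        (\<forall>x \<in> carrier L. \<mu> x \<le> 1 \<longrightarrow> \<mu> (\<sigma> x \<ominus>\<^bsub>L\<^esub> x [^]\<^bsub>L\<^esub> residue_cardinality k \<nu>) < 1))"

text \<open>
  The local invariant map of a completion \<open>k\<close> of a number field is the homomorphism
  \<open>Br k \<rightarrow> \<rat>/\<int>\<close> determined as follows. If \<open>k\<close> is nonarchimedean, it takes
  \<open>(L/k, Frob, \<pi>)\<close> to \<open>1/n\<close> for \<open>L/k\<close> unramified of degree \<open>n\<close>. If \<open>k \<cong> \<real>\<close>, it takes the class of the
  Hamilton quaternions \<open>(\<complex>/\<real>, conjugation, -1)\<close> to \<open>1/2\<close>. These classes exhaust or generate \<open>Br k\<close>.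
  If \<open>k \<cong> \<complex>\<close> then \<open>Br k = 0\<close>. An archimedean completion is isomorphic to \<open>\<real>\<close> if and only if it
  contains no square root of \<open>-1\<close>.
\<close>

definition local_invariant_map ::
  "('r, 'i) resolution \<Rightarrow> 'r ring \<Rightarrow> ('r \<Rightarrow> real) \<Rightarrow>
     (('r ring \<Rightarrow> ('r \<Rightarrow> 'r) \<Rightarrow> 'i) set \<Rightarrow> rat set) \<Rightarrow> bool" where
  "local_invariant_map I k \<nu> f \<longleftrightarrow> f \<in> hom (Br I (spec k)) QZ \<and>
     (nonarchimedean k \<nu> \<longrightarrow> (\<forall>n>0. \<forall>L j \<sigma> \<pi> \<alpha>.
        unramified_frobenius k \<nu> L j n \<sigma> \<and> uniformizer k \<nu> \<pi> \<and> cyclic_class I k L j \<sigma> n \<pi> \<alpha> \<longrightarrow>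
        f \<alpha> = QZ_of (1 / of_nat n))) \<and>
     (\<not> nonarchimedean k \<nu> \<and> (\<forall>x \<in> carrier k. x \<otimes>\<^bsub>k\<^esub> x \<noteq> \<ominus>\<^bsub>k\<^esub> \<one>\<^bsub>k\<^esub>) \<longrightarrow> (\<forall>L j \<sigma> \<alpha>.
        extension_automorphism k L j 2 \<sigma> \<and> (\<exists>x \<in> carrier L. \<sigma> x \<noteq> x) \<and>
        cyclic_class I k L j \<sigma> 2 (\<ominus>\<^bsub>k\<^esub> \<one>\<^bsub>k\<^esub>) \<alpha> \<longrightarrow>
        f \<alpha> = QZ_of (1 / 2)))"


section \<open>The Brauer-Manin obstruction\<close>

type_synonym ('r, 'i) invariants = "'r place \<Rightarrow> ('r ring \<Rightarrow> ('r \<Rightarrow> 'r) \<Rightarrow> 'i) set \<Rightarrow> rat set"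

definition local_inv_at ::
  "('r, 'i) resolution \<Rightarrow> ('r, 'x) kscheme \<Rightarrow> 'r completions \<Rightarrow> ('r, 'i) invariants \<Rightarrow> 'r place \<Rightarrow>
     ('r ring \<Rightarrow> 'x \<Rightarrow> 'i) set \<Rightarrow> 'x \<Rightarrow> rat set" where
  "local_inv_at I V D iv w \<A> Q = iv w (Br_eval I V (cfield D w) \<A> Q)"

definition inv_support ::
  "('r, 'i) resolution \<Rightarrow> 'r ring \<Rightarrow> ('r, 'x) kscheme \<Rightarrow> 'r completions \<Rightarrow> ('r, 'i) invariants \<Rightarrow>
     ('r ring \<Rightarrow> 'x \<Rightarrow> 'i) set \<Rightarrow> 'x \<Rightarrow> 'r place set" where
  "inv_support I K V D iv \<A> P =
     {w \<in> places K. local_inv_at I V D iv w \<A> (component V D P w) \<noteq> \<one>\<^bsub>QZ\<^esub>}"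

definition inv_sum ::
  "('r, 'i) resolution \<Rightarrow> 'r ring \<Rightarrow> ('r, 'x) kscheme \<Rightarrow> 'r completions \<Rightarrow> ('r, 'i) invariants \<Rightarrow>
     ('r ring \<Rightarrow> 'x \<Rightarrow> 'i) set \<Rightarrow> 'x \<Rightarrow> rat set" where
  "inv_sum I K V D iv \<A> P =
     finprod QZ (\<lambda>w. local_inv_at I V D iv w \<A> (component V D P w)) (inv_support I K V D iv \<A> P)"

text \<open>Elements \<open>\<beta>\<close> of \<open>B\<close> are cosets, whose elements \<open>\<A>\<close> are their representatives in \<open>Br V\<close>.\<close>

definition brauer_manin_obstruction ::
  "('r, 'i) resolution \<Rightarrow> 'r ring \<Rightarrow> ('r, 'x) kscheme \<Rightarrow> 'r completions \<Rightarrow> ('r, 'i) invariants \<Rightarrow>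
     ('r ring \<Rightarrow> 'x \<Rightarrow> 'i) set set set \<Rightarrow> bool" where
  "brauer_manin_obstruction I K V D iv B \<longleftrightarrow>
     \<not> (\<exists>P \<in> adelic_points K V D. \<forall>\<beta> \<in> B. \<forall>\<A> \<in> \<beta>. inv_sum I K V D iv \<A> P = \<one>\<^bsub>QZ\<^esub>)"

text \<open>The existential quantifier over the base point \<open>P\<close> includes that there is a local point.\<close>

definition prolific ::
  "('r, 'i) resolution \<Rightarrow> 'r ring \<Rightarrow> ('r, 'x) kscheme \<Rightarrow> 'r completions \<Rightarrow> ('r, 'i) invariants \<Rightarrow>
     ('r ring \<Rightarrow> 'x \<Rightarrow> 'i) set set set \<Rightarrow> 'r place \<Rightarrow> bool" where
  "prolific I K V D iv B v \<longleftrightarrow>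
     (\<exists>P \<in> local_points V D v. \<forall>\<psi> \<in> hom ((Br_mod_const I K V)\<lparr>carrier := B\<rparr>) QZ.
        \<exists>Q \<in> local_points V D v. \<forall>\<beta> \<in> B. \<forall>\<A> \<in> \<beta>.
          local_inv_at I V D iv v \<A> Q \<otimes>\<^bsub>QZ\<^esub> inv\<^bsub>QZ\<^esub> (local_inv_at I V D iv v \<A> P) = \<psi> \<beta>)"

text \<open>For every adelic point, the sum of the local invariants is finite and depends only on the
  class of \<open>\<A>\<close> modulo the image of \<open>Br K\<close>. This is a theorem of global class field theory.\<close>

definition inv_sum_well_defined ::
  "('r, 'i) resolution \<Rightarrow> 'r ring \<Rightarrow> ('r, 'x) kscheme \<Rightarrow> 'r completions \<Rightarrow> ('r, 'i) invariants \<Rightarrow> bool" where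
  "inv_sum_well_defined I K V D iv \<longleftrightarrow> (\<forall>P \<in> adelic_points K V D.
     (\<forall>\<A> \<in> carrier (Br I V). finite (inv_support I K V D iv \<A> P)) \<and>
     (\<forall>\<beta> \<in> carrier (Br_mod_const I K V). \<forall>\<A> \<in> \<beta>. \<forall>\<A>' \<in> \<beta>.
        inv_sum I K V D iv \<A> P = inv_sum I K V D iv \<A>' P))"

end

theory Submission
  imports Defs
begin

text \<open>
  Since \<open>\<bbbA>\<^sub>K\<close> is the product of \<open>K\<^sub>v\<close> and the ring of adeles away from \<open>v\<close>, the component at \<open>v\<close>
  of an adelic point can be replaced by any other local point. Let \<open>P\<close> be an adelic point whose
  component at \<open>v\<close> is the base point of the pairing. Then \<open>\<A> \<mapsto> - \<Sum>\<^sub>w inv\<^sub>w \<A>(P\<^sub>w)\<close> is a homomorphism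
  \<open>B \<rightarrow> \<rat>/\<int>\<close>, so it is \<open>inv\<^sub>v \<A>(Q) - inv\<^sub>v \<A>(P\<^sub>v)\<close> for some local point \<open>Q\<close>. Replacing \<open>P\<^sub>v\<close> by \<open>Q\<close>
  makes all sums vanish.
\<close>

text \<open>An adelic point is an element of \<open>pts V (adeles D)\<close>, not a family of local
  points, so a component cannot simply be overwritten. An idempotent splits the adele ring into two
  factors; their spectra form a disjoint Zariski cover, and the sheaf condition glues a point over
  one factor to any point over the other. The structure map to \<open>K\<close> is then checked
  place by place. Additivity of the local terms in \<A> is not part of the data either: evaluation
  is a pullback of cosets of cocycles, so it has to be shown that cohomology consists of abelian
  groups and that pullback is a homomorphism. The global input is
  \<open>inv_sum_well_defined\<close>. It makes the sum finite and makes it a function on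
  \<open>B\<close>, whose elements are only classes modulo constants. Prolificness speaks about
  \<open>v\<close> alone; the local points at all other places come from a given adelic
  point.\<close>

section \<open>Homomorphisms induced on quotients of abelian groups\<close>

lemma hom_one_groups: "h \<in> hom G H \<Longrightarrow> group G \<Longrightarrow> group H \<Longrightarrow> h \<one>\<^bsub>G\<^esub> = \<one>\<^bsub>H\<^esub>"
  by (rule group_hom.hom_one) (simp add: group_hom_def group_hom_axioms_def)

text \<open>The image of a coset of \<open>N\<close> is in general only part of a coset of
  \<open>M\<close>; multiplying by \<open>M\<close> fills it up. The factor \<open>h n\<close> is
  absorbed into \<open>M\<close>, and conversely \<open>z\<close> itself is an element of its
  coset.\<close>

lemma coset_map_r_coset:
  assumes "comm_group G" "comm_group H" "subgroup N G" "subgroup M H" "h \<in> hom G H"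
    and sub: "h ` N \<subseteq> M" and z: "z \<in> carrier G"
  shows "M <#>\<^bsub>H\<^esub> h ` (N #>\<^bsub>G\<^esub> z) = M #>\<^bsub>H\<^esub> h z"
proof -
  interpret G: comm_group G by fact
  interpret H: comm_group H by fact
  interpret N: subgroup N G by fact
  interpret M: subgroup M H by fact
  have hz: "h z \<in> carrier H" using assms(5) z by (auto simp: hom_def)
  have eq: "h (n \<otimes>\<^bsub>G\<^esub> z) = h n \<otimes>\<^bsub>H\<^esub> h z" "h n \<in> M" if "n \<in> N" for n
    using assms(5) sub z that by (auto simp: hom_def)
  show ?thesis
  proof (intro equalityI subsetI)
    fix x assume "x \<in> M <#>\<^bsub>H\<^esub> h ` (N #>\<^bsub>G\<^esub> z)"
    then obtain m n where mn: "m \<in> M" "n \<in> N" "x = m \<otimes>\<^bsub>H\<^esub> h (n \<otimes>\<^bsub>G\<^esub> z)"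
      by (auto simp: set_mult_def r_coset_def)
    then have "x = (m \<otimes>\<^bsub>H\<^esub> h n) \<otimes>\<^bsub>H\<^esub> h z"
      using eq[OF mn(2)] hz by (simp add: H.m_assoc)
    then show "x \<in> M #>\<^bsub>H\<^esub> h z"
      using mn eq by (auto simp: r_coset_def)
  next
    fix x assume "x \<in> M #>\<^bsub>H\<^esub> h z"
    then obtain m where m: "m \<in> M" "x = m \<otimes>\<^bsub>H\<^esub> h z" by (auto simp: r_coset_def)
    have "z \<in> N #>\<^bsub>G\<^esub> z" using z assms(3) by (rule G.rcos_self)
    then show "x \<in> M <#>\<^bsub>H\<^esub> h ` (N #>\<^bsub>G\<^esub> z)"
      using m by (auto simp: set_mult_def)
  qed
qed

text \<open>This map on cosets has the exact form of \<open>pullback\<close>, with cocycles for the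
  groups and coboundaries for the subgroups.\<close>

lemma coset_map_hom:
  assumes "comm_group G" "comm_group H" "subgroup N G" "subgroup M H" "h \<in> hom G H"
    and "h ` N \<subseteq> M"
  shows "(\<lambda>c. M <#>\<^bsub>H\<^esub> h ` c) \<in> hom (G Mod N) (H Mod M)"
proof -
  interpret G: comm_group G by fact
  interpret H: comm_group H by fact
  interpret N: normal N G using assms(3) by (rule G.subgroup_imp_normal)
  interpret M: normal M H using assms(4) by (rule H.subgroup_imp_normal)
  note coset = coset_map_r_coset[OF assms]
  have h: "h z \<in> carrier H" if "z \<in> carrier G" for z using assms(5) that by (auto simp: hom_def)
  show ?thesis
  proof (rule homI)
    fix c assume "c \<in> carrier (G Mod N)"
    then obtain z where z: "z \<in> carrier G" "c = N #>\<^bsub>G\<^esub> z"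
      by (auto simp: FactGroup_def RCOSETS_def)
    then show "M <#>\<^bsub>H\<^esub> h ` c \<in> carrier (H Mod M)"
      using coset[OF z(1)] h by (auto simp: FactGroup_def RCOSETS_def)
  next
    fix c d assume "c \<in> carrier (G Mod N)" "d \<in> carrier (G Mod N)"
    then obtain y z where z: "z \<in> carrier G" "d = N #>\<^bsub>G\<^esub> z" and y: "y \<in> carrier G" "c = N #>\<^bsub>G\<^esub> y"
      by (auto simp: FactGroup_def RCOSETS_def)
    have "h (y \<otimes>\<^bsub>G\<^esub> z) = h y \<otimes>\<^bsub>H\<^esub> h z" using assms(5) y z by (auto simp: hom_def)
    then show "M <#>\<^bsub>H\<^esub> h ` (c \<otimes>\<^bsub>G Mod N\<^esub> d) =
        (M <#>\<^bsub>H\<^esub> h ` c) \<otimes>\<^bsub>H Mod M\<^esub> (M <#>\<^bsub>H\<^esub> h ` d)"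
      using y z h by (simp add: N.rcos_sum coset M.rcos_sum)
  qed
qed


section \<open>Functoriality of cohomology\<close>

lemma is_functor_act_closed:
  "is_functor V \<Longrightarrow> f \<in> rhom R S \<Longrightarrow> x \<in> pts V R \<Longrightarrow> act V R S f x \<in> pts V S"
  unfolding is_functor_def by blast

lemma rhom_cring: "f \<in> rhom R S \<Longrightarrow> cring R" "f \<in> rhom R S \<Longrightarrow> cring S"
  by (auto simp: rhom_def)

lemma is_absheafD:
  assumes "is_absheaf F"
  shows "cring R \<Longrightarrow> comm_group (grp F R)"
    and "f \<in> rhom R S \<Longrightarrow> res F R S f \<in> hom (grp F R) (grp F S)"
  using assms unfolding is_absheaf_def by blast+

lemma on_points_apply: "cring R \<Longrightarrow> x \<in> pts V R \<Longrightarrow> on_points V s R x = s R x"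
  by (simp add: on_points_def)

lemma on_points_eqI:
  "(\<And>R x. cring R \<Longrightarrow> x \<in> pts V R \<Longrightarrow> s R x = t R x) \<Longrightarrow> on_points V s = on_points V t"
  by (auto simp: on_points_def fun_eq_iff)

lemma on_points_idem [simp]: "on_points V (on_points V s) = on_points V s"
  by (auto simp: on_points_def fun_eq_iff)

lemma on_points_in_sections:
  assumes V: "is_functor V"
    and "\<And>R x. cring R \<Longrightarrow> x \<in> pts V R \<Longrightarrow> s R x \<in> carrier (grp F R)"
    and "\<And>R S f x. f \<in> rhom R S \<Longrightarrow> x \<in> pts V R \<Longrightarrow> s S (act V R S f x) = res F R S f (s R x)"
  shows "on_points V s \<in> carrier (sections V F)"
  using assms(2,3) is_functor_act_closed[OF V]
  by (simp add: sections_def nat_trans_def underlying_def on_points_apply rhom_cring)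

lemma sectionsD:
  assumes "s \<in> carrier (sections V F)"
  shows "cring R \<Longrightarrow> x \<in> pts V R \<Longrightarrow> s R x \<in> carrier (grp F R)"
    and "f \<in> rhom R S \<Longrightarrow> x \<in> pts V R \<Longrightarrow> s S (act V R S f x) = res F R S f (s R x)"
    and "on_points V s = s"
  using assms unfolding sections_def nat_trans_def underlying_def by simp_all

lemma sections_eqI:
  assumes "s \<in> carrier (sections V F)" "t \<in> carrier (sections V F)"
    and "\<And>R x. cring R \<Longrightarrow> x \<in> pts V R \<Longrightarrow> s R x = t R x"
  shows "s = t"
  using on_points_eqI[of V s t] assms sectionsD(3) by metis

lemma sections_mult: "s \<otimes>\<^bsub>sections V F\<^esub> t = on_points V (\<lambda>R x. s R x \<otimes>\<^bsub>grp F R\<^esub> t R x)"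
  and sections_one: "\<one>\<^bsub>sections V F\<^esub> = on_points V (\<lambda>R x. \<one>\<^bsub>grp F R\<^esub>)"
  by (simp_all add: sections_def)

lemma sections_mult_closed:
  assumes "is_functor V" "is_absheaf F" "s \<in> carrier (sections V F)" "t \<in> carrier (sections V F)"
  shows "s \<otimes>\<^bsub>sections V F\<^esub> t \<in> carrier (sections V F)"
  unfolding sections_mult
proof (rule on_points_in_sections[OF assms(1)])
  fix R x assume R: "cring R" "x \<in> pts V R"
  interpret comm_group "grp F R" using is_absheafD(1)[OF assms(2) R(1)] .
  show "s R x \<otimes>\<^bsub>grp F R\<^esub> t R x \<in> carrier (grp F R)"
    using m_closed[OF sectionsD(1)[OF assms(3) R] sectionsD(1)[OF assms(4) R]] .
next
  fix R S f x assume f: "f \<in> rhom R S" "x \<in> pts V R"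
  show "s S (act V R S f x) \<otimes>\<^bsub>grp F S\<^esub> t S (act V R S f x) = res F R S f (s R x \<otimes>\<^bsub>grp F R\<^esub> t R x)"
    using hom_mult[OF is_absheafD(2)[OF assms(2) f(1)]] assms(3,4) f
    by (simp add: sectionsD(1,2) rhom_cring(1)[OF f(1)])
qed

text \<open>All operations are pointwise, so the group laws hold value by value. Products, the unit
  and inverses of sections are natural because the restriction maps of the sheaf are group
  homomorphisms.\<close>

lemma comm_group_sections:
  assumes V: "is_functor V" and F: "is_absheaf F"
  shows "comm_group (sections V F)"
proof (rule comm_groupI)
  note grp = is_absheafD(1)[OF F]
  show one: "\<one>\<^bsub>sections V F\<^esub> \<in> carrier (sections V F)"
    unfolding sections_one
  proof (rule on_points_in_sections[OF V])
    show "\<one>\<^bsub>grp F R\<^esub> \<in> carrier (grp F R)" if "cring R" for R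
      using grp[OF that] by (simp add: comm_group_def group_def monoid.one_closed)
    show "\<one>\<^bsub>grp F S\<^esub> = res F R S f \<one>\<^bsub>grp F R\<^esub>" if "f \<in> rhom R S" for R S f
      using hom_one_groups[OF is_absheafD(2)[OF F that]] grp rhom_cring[OF that]
      by (simp add: comm_group_def)
  qed
  note closed = sections_mult_closed[OF V F]
  show "s \<otimes>\<^bsub>sections V F\<^esub> t \<in> carrier (sections V F)"
    if "s \<in> carrier (sections V F)" "t \<in> carrier (sections V F)" for s t
    using closed that .
  show "s \<otimes>\<^bsub>sections V F\<^esub> t \<otimes>\<^bsub>sections V F\<^esub> u = s \<otimes>\<^bsub>sections V F\<^esub> (t \<otimes>\<^bsub>sections V F\<^esub> u)"
    if s: "s \<in> carrier (sections V F)" "t \<in> carrier (sections V F)" "u \<in> carrier (sections V F)" for s t u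
  proof (rule sections_eqI[OF closed[OF closed[OF s(1,2)] s(3)] closed[OF s(1) closed[OF s(2,3)]]])
    fix R x assume R: "cring R" "x \<in> pts V R"
    interpret comm_group "grp F R" using grp[OF R(1)] .
    show "(s \<otimes>\<^bsub>sections V F\<^esub> t \<otimes>\<^bsub>sections V F\<^esub> u) R x = (s \<otimes>\<^bsub>sections V F\<^esub> (t \<otimes>\<^bsub>sections V F\<^esub> u)) R x"
      using R by (simp add: sections_mult on_points_apply sectionsD(1)[OF s(1)] sectionsD(1)[OF s(2)]
          sectionsD(1)[OF s(3)] m_assoc)
  qed
  show "s \<otimes>\<^bsub>sections V F\<^esub> t = t \<otimes>\<^bsub>sections V F\<^esub> s"
    if s: "s \<in> carrier (sections V F)" "t \<in> carrier (sections V F)" for s t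
    unfolding sections_mult
  proof (rule on_points_eqI)
    fix R x assume R: "cring R" "x \<in> pts V R"
    interpret comm_group "grp F R" using grp[OF R(1)] .
    show "s R x \<otimes>\<^bsub>grp F R\<^esub> t R x = t R x \<otimes>\<^bsub>grp F R\<^esub> s R x"
      using R by (simp add: sectionsD(1)[OF s(1)] sectionsD(1)[OF s(2)] m_comm)
  qed
  show "\<one>\<^bsub>sections V F\<^esub> \<otimes>\<^bsub>sections V F\<^esub> s = s" if s: "s \<in> carrier (sections V F)" for s
  proof (rule sections_eqI[OF closed[OF one s] s])
    fix R x assume R: "cring R" "x \<in> pts V R"
    interpret comm_group "grp F R" using grp[OF R(1)] .
    show "(\<one>\<^bsub>sections V F\<^esub> \<otimes>\<^bsub>sections V F\<^esub> s) R x = s R x"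
      using R by (simp add: sections_mult sections_one on_points_apply sectionsD(1)[OF s])
  qed
  show "\<exists>t\<in>carrier (sections V F). t \<otimes>\<^bsub>sections V F\<^esub> s = \<one>\<^bsub>sections V F\<^esub>"
    if s: "s \<in> carrier (sections V F)" for s
  proof
    let ?t = "on_points V (\<lambda>R x. inv\<^bsub>grp F R\<^esub> (s R x))"
    show t: "?t \<in> carrier (sections V F)"
    proof (rule on_points_in_sections[OF V])
      show "inv\<^bsub>grp F R\<^esub> (s R x) \<in> carrier (grp F R)" if "cring R" "x \<in> pts V R" for R x
        using grp[OF that(1)] sectionsD(1)[OF s that] by (simp add: comm_group_def group.inv_closed)
      show "inv\<^bsub>grp F S\<^esub> s S (act V R S f x) = res F R S f (inv\<^bsub>grp F R\<^esub> s R x)"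
        if f: "f \<in> rhom R S" "x \<in> pts V R" for R S f x
      proof -
        interpret group_hom "grp F R" "grp F S" "res F R S f"
          using is_absheafD(2)[OF F f(1)] grp rhom_cring[OF f(1)]
          by (simp add: group_hom_def group_hom_axioms_def comm_group_def)
        show ?thesis using f s by (simp add: sectionsD rhom_cring(1)[OF f(1)])
      qed
    qed
    show "?t \<otimes>\<^bsub>sections V F\<^esub> s = \<one>\<^bsub>sections V F\<^esub>"
    proof (rule sections_eqI[OF closed[OF t s] one])
      fix R x assume R: "cring R" "x \<in> pts V R"
      interpret comm_group "grp F R" using grp[OF R(1)] .
      show "(?t \<otimes>\<^bsub>sections V F\<^esub> s) R x = \<one>\<^bsub>sections V F\<^esub> R x"
        using R by (simp add: sections_mult sections_one on_points_apply sectionsD(1)[OF s])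
    qed
  qed
qed

lemma resolutionD:
  assumes "Gm_injective_resolution I"
  shows "is_absheaf (obj I n)"
    and "absheaf_hom (obj I n) (obj I (Suc n)) (diff I n)"
    and "cring R \<Longrightarrow> x \<in> carrier (grp (obj I n) R) \<Longrightarrow>
           diff I (Suc n) R (diff I n R x) = \<one>\<^bsub>grp (obj I (Suc (Suc n))) R\<^esub>"
  using assms by (auto simp: Gm_injective_resolution_def injective_absheaf_def absheaf_exact_def)

lemma section_diff_hom:
  assumes V: "is_functor V" and I: "Gm_injective_resolution I"
  shows "section_diff I n V \<in> hom (sections V (obj I n)) (sections V (obj I (Suc n)))"
proof (rule homI)
  have d: "diff I n R \<in> hom (grp (obj I n) R) (grp (obj I (Suc n)) R)" if "cring R" for R
    using resolutionD(2)[OF I, of n] that by (auto simp: absheaf_hom_def)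
  have nat: "diff I n S (res (obj I n) R S f y) = res (obj I (Suc n)) R S f (diff I n R y)"
    if "f \<in> rhom R S" "y \<in> carrier (grp (obj I n) R)" for R S f y
    using resolutionD(2)[OF I, of n] that by (auto simp: absheaf_hom_def nat_trans_def underlying_def)
  show "section_diff I n V s \<in> carrier (sections V (obj I (Suc n)))"
    if s: "s \<in> carrier (sections V (obj I n))" for s
    unfolding section_diff_def
  proof (rule on_points_in_sections[OF V])
    show "diff I n R (s R x) \<in> carrier (grp (obj I (Suc n)) R)" if "cring R" "x \<in> pts V R" for R x
      using hom_in_carrier[OF d[OF that(1)] sectionsD(1)[OF s that]] .
    show "diff I n S (s S (act V R S f x)) = res (obj I (Suc n)) R S f (diff I n R (s R x))"
      if "f \<in> rhom R S" "x \<in> pts V R" for R S f x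
      using nat[OF that(1) sectionsD(1)[OF s rhom_cring(1)[OF that(1)] that(2)]] sectionsD(2)[OF s that]
      by simp
  qed
  show "section_diff I n V (s \<otimes>\<^bsub>sections V (obj I n)\<^esub> t) =
      section_diff I n V s \<otimes>\<^bsub>sections V (obj I (Suc n))\<^esub> section_diff I n V t"
    if s: "s \<in> carrier (sections V (obj I n))" "t \<in> carrier (sections V (obj I n))" for s t
    unfolding section_diff_def sections_mult
    using sectionsD(1)[OF s(1)] sectionsD(1)[OF s(2)] hom_mult[OF d]
    by (intro on_points_eqI) (auto simp: on_points_apply)
qed

lemma subgroup_cocycles:
  assumes V: "is_functor V" and I: "Gm_injective_resolution I"
  shows "subgroup (carrier (cocycles I n V)) (sections V (obj I n))"
proof -
  interpret group_hom "sections V (obj I n)" "sections V (obj I (Suc n))" "section_diff I n V"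
    using comm_group_sections[OF V resolutionD(1)[OF I]] section_diff_hom[OF V I]
    by (simp add: group_hom_def group_hom_axioms_def comm_group_def)
  show ?thesis using subgroup_kernel by (simp add: cocycles_def)
qed

lemma comm_group_cocycles:
  assumes V: "is_functor V" and I: "Gm_injective_resolution I"
  shows "comm_group (cocycles I n V)"
proof -
  interpret comm_group "sections V (obj I n)"
    using comm_group_sections[OF V resolutionD(1)[OF I]] .
  have sub: "subgroup (carrier (cocycles I n V)) (sections V (obj I n))"
    using subgroup_cocycles[OF V I] .
  have "comm_group ((sections V (obj I n))\<lparr>carrier := carrier (cocycles I n V)\<rparr>)"
    by (rule group.group_comm_groupI[OF subgroup.subgroup_is_group[OF sub group_axioms]])
      (simp add: m_comm subgroup.mem_carrier[OF sub])
  then show ?thesis by (simp add: cocycles_def)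
qed

text \<open>In degree 0 this is the trivial subgroup. In positive degree it is the image of a
  homomorphism, and it consists of cocycles because two successive differentials compose to the
  trivial map.\<close>

lemma subgroup_coboundaries:
  assumes V: "is_functor V" and I: "Gm_injective_resolution I"
  shows "subgroup (coboundaries I n V) (cocycles I n V)"
proof (cases n)
  case 0
  have "\<one>\<^bsub>cocycles I 0 V\<^esub> = \<one>\<^bsub>sections V (obj I 0)\<^esub>" by (simp add: cocycles_def)
  then show ?thesis
    using group.triv_subgroup[of "cocycles I 0 V"] comm_group_cocycles[OF V I] 0
    by (simp add: coboundaries_def comm_group_def)
next
  case (Suc m)
  interpret d: group_hom "sections V (obj I m)" "sections V (obj I (Suc m))" "section_diff I m V"
    using comm_group_sections[OF V resolutionD(1)[OF I]] section_diff_hom[OF V I]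
    by (simp add: group_hom_def group_hom_axioms_def comm_group_def)
  have "subgroup (coboundaries I n V) (sections V (obj I n))"
    using d.img_is_subgroup Suc by (simp add: coboundaries_def)
  moreover have "coboundaries I n V \<subseteq> carrier (cocycles I n V)"
  proof
    fix c assume "c \<in> coboundaries I n V"
    then obtain s where s: "s \<in> carrier (sections V (obj I m))" "c = section_diff I m V s"
      using Suc by (auto simp: coboundaries_def)
    have "section_diff I (Suc m) V c = \<one>\<^bsub>sections V (obj I (Suc (Suc m)))\<^esub>"
      unfolding s(2) section_diff_def sections_one
      by (rule on_points_eqI) (simp add: on_points_apply resolutionD(3)[OF I] sectionsD(1)[OF s(1)])
    then show "c \<in> carrier (cocycles I n V)"
      using s Suc d.hom_closed by (simp add: cocycles_def kernel_def)
  qed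
  ultimately show ?thesis
    using group.subgroup_incl[OF _ _ subgroup_cocycles[OF V I, of n]]
      comm_group.axioms(2)[OF comm_group_sections[OF V resolutionD(1)[OF I, of n]]]
    by (simp add: cocycles_def)
qed

lemma comm_group_cohomology:
  assumes "is_functor V" and "Gm_injective_resolution I"
  shows "comm_group (cohomology I n V)"
  unfolding cohomology_def
  using comm_group.abelian_FactGroup[OF comm_group_cocycles[OF assms] subgroup_coboundaries[OF assms]] .

lemma nat_transD:
  assumes "nat_trans Y V t"
  shows "cring R \<Longrightarrow> y \<in> pts Y R \<Longrightarrow> t R y \<in> pts V R"
    and "f \<in> rhom R S \<Longrightarrow> y \<in> pts Y R \<Longrightarrow> t S (act Y R S f y) = act V R S f (t R y)"
  using assms unfolding nat_trans_def by blast+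

text \<open>Precomposition with \<open>t\<close> commutes with everything that is defined pointwise:
  products, units and the differentials of the resolution. It therefore maps cocycles to cocycles
  and coboundaries to coboundaries, and descends to cosets.\<close>

lemma pullback_hom:
  fixes V :: "('r, 'x, 'z) ringfun_scheme" and Y :: "('r, 'y, 'w) ringfun_scheme"
    and I :: "('r, 'i) resolution"
  assumes V: "is_functor V" and Y: "is_functor Y" and I: "Gm_injective_resolution I"
    and t: "nat_trans Y V t"
  shows "pullback I n Y t \<in> hom (cohomology I n V) (cohomology I n Y)"
proof -
  define h where "h s = on_points Y (\<lambda>R y. s R (t R y))" for s :: "'r ring \<Rightarrow> 'x \<Rightarrow> 'i"
  note tD = nat_transD[OF t]
  have h_closed: "h s \<in> carrier (sections Y (obj I m))" if s: "s \<in> carrier (sections V (obj I m))" for s m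
    unfolding h_def
  proof (rule on_points_in_sections[OF Y])
    show "s R (t R y) \<in> carrier (grp (obj I m) R)" if "cring R" "y \<in> pts Y R" for R y
      using sectionsD(1)[OF s that(1) tD(1)[OF that]] .
    show "s S (t S (act Y R S f y)) = res (obj I m) R S f (s R (t R y))"
      if f: "f \<in> rhom R S" "y \<in> pts Y R" for R S f y
      using sectionsD(2)[OF s f(1) tD(1)[OF rhom_cring(1)[OF f(1)] f(2)]] tD(2)[OF f] by simp
  qed
  have h_diff: "h (section_diff I m V s) = section_diff I m Y (h s)"
    if s: "s \<in> carrier (sections V (obj I m))" for s m
    unfolding h_def section_diff_def by (rule on_points_eqI) (simp add: on_points_apply tD)
  have h_one: "h \<one>\<^bsub>sections V F\<^esub> = \<one>\<^bsub>sections Y F\<^esub>" for F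
    unfolding h_def sections_one by (rule on_points_eqI) (simp add: on_points_apply tD)
  have h_mult: "h (s \<otimes>\<^bsub>sections V F\<^esub> s') = h s \<otimes>\<^bsub>sections Y F\<^esub> h s'" for s s' F
    unfolding h_def sections_mult by (rule on_points_eqI) (simp add: on_points_apply tD)
  have "h \<in> hom (cocycles I n V) (cocycles I n Y)"
  proof (rule homI)
    fix s assume "s \<in> carrier (cocycles I n V)"
    then have s: "s \<in> carrier (sections V (obj I n))"
        "section_diff I n V s = \<one>\<^bsub>sections V (obj I (Suc n))\<^esub>"
      by (simp_all add: cocycles_def kernel_def)
    show "h s \<in> carrier (cocycles I n Y)"
      using h_diff[OF s(1)] s by (simp add: cocycles_def kernel_def h_closed h_one)
  qed (simp add: cocycles_def h_mult)
  moreover have "h ` coboundaries I n V \<subseteq> coboundaries I n Y"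
    by (cases n) (auto simp: coboundaries_def h_one h_diff h_closed)
  ultimately have "(\<lambda>c. coboundaries I n Y <#>\<^bsub>cocycles I n Y\<^esub> h ` c) \<in> hom (cohomology I n V) (cohomology I n Y)"
    unfolding cohomology_def
    using comm_group_cocycles[OF V I] comm_group_cocycles[OF Y I]
      subgroup_coboundaries[OF V I] subgroup_coboundaries[OF Y I] by (intro coset_map_hom)
  moreover have "pullback I n Y t = (\<lambda>c. coboundaries I n Y <#>\<^bsub>cocycles I n Y\<^esub> h ` c)"
    unfolding pullback_def[abs_def] h_def ..
  ultimately show ?thesis by simp
qed

section \<open>Evaluation of Brauer classes at points\<close>

lemma rhomD:
  assumes "f \<in> rhom R S"
  shows "x \<in> carrier R \<Longrightarrow> f x \<in> carrier S"
    and "x \<in> carrier R \<Longrightarrow> y \<in> carrier R \<Longrightarrow> f (x \<otimes>\<^bsub>R\<^esub> y) = f x \<otimes>\<^bsub>S\<^esub> f y"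
    and "x \<in> carrier R \<Longrightarrow> y \<in> carrier R \<Longrightarrow> f (x \<oplus>\<^bsub>R\<^esub> y) = f x \<oplus>\<^bsub>S\<^esub> f y"
    and "f \<one>\<^bsub>R\<^esub> = \<one>\<^bsub>S\<^esub>"
    and "f \<zero>\<^bsub>R\<^esub> = \<zero>\<^bsub>S\<^esub>"
    and "f \<in> extensional (carrier R)"
proof -
  have f: "f \<in> ring_hom R S" "cring R" "cring S" using assms by (auto simp: rhom_def)
  then interpret ring_hom_ring R S f by (intro ring_hom_ringI2) (auto simp: cring_def)
  show "f \<zero>\<^bsub>R\<^esub> = \<zero>\<^bsub>S\<^esub>" "f \<one>\<^bsub>R\<^esub> = \<one>\<^bsub>S\<^esub>" by simp_all
  show "f \<in> extensional (carrier R)" using assms by (simp add: rhom_def)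
qed (use assms in \<open>auto simp: rhom_def ring_hom_def\<close>)

lemma compose_rhom:
  assumes f: "f \<in> rhom R S" and g: "g \<in> rhom S T"
  shows "compose (carrier R) g f \<in> rhom R T"
proof -
  interpret R: cring R using rhom_cring(1)[OF f] .
  have "compose (carrier R) g f \<in> ring_hom R T"
    by (rule ring_hom_memI) (simp_all add: compose_def rhomD[OF f] rhomD[OF g])
  then show ?thesis using rhom_cring[OF f] rhom_cring[OF g] by (simp add: rhom_def)
qed

lemma is_functor_spec: "is_functor (spec L)"
proof -
  have "compose (carrier L) (\<lambda>a\<in>carrier R. a) x = x" if "x \<in> rhom L R" for x R
    by (rule extensionalityI[of _ "carrier L"]) (simp_all add: compose_def rhomD[OF that])
  moreover have "compose (carrier L) (compose (carrier R) g f) x = compose (carrier L) g (compose (carrier L) f x)"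
    if "x \<in> rhom L R" for x R and f g :: "'a \<Rightarrow> 'a"
    by (rule extensionalityI[of _ "carrier L"]) (simp_all add: compose_def rhomD[OF that])
  ultimately show ?thesis
    unfolding is_functor_def spec_def by (simp add: compose_rhom)
qed

text \<open>One direction of the Yoneda lemma: an \<open>L\<close>-point is a morphism from the
  spectrum of \<open>L\<close>. This makes evaluation at a point an instance of pullback, and hence
  additive.\<close>

lemma nat_trans_yoneda:
  assumes V: "is_functor V" and P: "P \<in> pts V L"
  shows "nat_trans (spec L) V (yoneda V L P)"
proof -
  have "act V L S (compose (carrier L) f y) P = act V R S f (act V L R y P)"
    if "f \<in> rhom R S" "y \<in> rhom L R" for R S f y
    using V P that unfolding is_functor_def by blast
  moreover have "act V L R y P \<in> pts V R" if "y \<in> rhom L R" for R y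
    using is_functor_act_closed[OF V that P] .
  ultimately show ?thesis
    unfolding nat_trans_def spec_def yoneda_def by simp
qed

lemma Br_eval_hom:
  assumes "is_functor V" "Gm_injective_resolution I" "P \<in> pts V L"
  shows "(\<lambda>\<A>. Br_eval I V L \<A> P) \<in> hom (Br I V) (Br I (spec L))"
  unfolding Br_eval_def Br_def
  using pullback_hom[OF assms(1) is_functor_spec assms(2) nat_trans_yoneda[OF assms(1,3)]] .

text \<open>Allows representatives of classes to be chosen and used as elements of
  \<open>Br I V\<close>. The cosets are non-empty because the constant classes contain the pullback
  of the unit of the Brauer group of \<open>K\<close>.\<close>

lemma Br_mod_const_subset:
  assumes V: "is_functor V" and I: "Gm_injective_resolution I" and t: "nat_trans V (spec K) (str V)"
    and \<beta>: "\<beta> \<in> carrier (Br_mod_const I K V)"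
  shows "\<beta> \<subseteq> carrier (Br I V)" "\<beta> \<noteq> {}"
proof -
  interpret comm_group "Br I V" unfolding Br_def using comm_group_cohomology[OF V I] .
  interpret S: comm_group "Br I (spec K)" unfolding Br_def using comm_group_cohomology[OF is_functor_spec I] .
  have "Br_const I K V \<subseteq> carrier (Br I V)"
    using pullback_hom[OF is_functor_spec V I t, of 2] by (auto simp: Br_const_def Br_def hom_def)
  moreover have "Br_const I K V \<noteq> {}" using S.one_closed by (auto simp: Br_const_def)
  ultimately show "\<beta> \<subseteq> carrier (Br I V)" "\<beta> \<noteq> {}"
    using \<beta> by (auto simp: Br_mod_const_def FactGroup_def RCOSETS_def r_coset_def)
qed

section \<open>Gluing points along idempotents\<close>

lemma rhom_eqI:
  assumes "g \<in> rhom R S" "h \<in> rhom R S" "\<And>x. x \<in> carrier R \<Longrightarrow> g x = h x"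
  shows "g = h"
  using rhomD(6)[OF assms(1)] rhomD(6)[OF assms(2)] assms(3) by (rule extensionalityI)

lemma rhom_eq_on_surj:
  assumes "g \<in> rhom B C" "h \<in> rhom B C" "f ` carrier A = carrier B"
    and "compose (carrier A) g f = compose (carrier A) h f"
  shows "g = h"
proof (rule rhom_eqI[OF assms(1,2)])
  fix x assume "x \<in> carrier B"
  then obtain a where a: "a \<in> carrier A" "x = f a" using assms(3) by auto
  show "g x = h x" using fun_cong[OF assms(4), of a] a by (simp add: compose_def)
qed

text \<open>Inverting an idempotent \<open>e\<close> amounts to projecting to the factor on which
  \<open>e\<close> is 1. If \<open>g\<close> makes \<open>e\<close> invertible, then
  \<open>g e\<close> is an invertible idempotent, hence 1, so \<open>g a\<close> depends only on the
  product of \<open>e\<close> and \<open>a\<close>. By the last hypothesis that product is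
  determined by \<open>f a\<close>, and \<open>g\<close> factors through \<open>f\<close>.\<close>

lemma is_localization_idempotent:
  assumes f: "f \<in> rhom A B" and surj: "f ` carrier A = carrier B"
    and e: "e \<in> carrier A" "e \<otimes>\<^bsub>A\<^esub> e = e" and fe: "f e = \<one>\<^bsub>B\<^esub>"
    and ker: "\<And>a b. a \<in> carrier A \<Longrightarrow> b \<in> carrier A \<Longrightarrow> f a = f b \<Longrightarrow> e \<otimes>\<^bsub>A\<^esub> a = e \<otimes>\<^bsub>A\<^esub> b"
  shows "is_localization A e B f"
  unfolding is_localization_def
proof (intro conjI allI ballI impI)
  interpret A: cring A using rhom_cring(1)[OF f] .
  interpret B: cring B using rhom_cring(2)[OF f] .
  show "e \<in> carrier A" "f \<in> rhom A B" "f e \<in> Units B" using e f fe by auto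
  fix C g assume g: "g \<in> rhom A C" and unit: "g e \<in> Units C"
  interpret C: cring C using rhom_cring(2)[OF g] .
  note gD = rhomD[OF g] and fD = rhomD[OF f]
  have "g e \<otimes>\<^bsub>C\<^esub> g e = g e \<otimes>\<^bsub>C\<^esub> \<one>\<^bsub>C\<^esub>"
    using gD(2)[OF e(1) e(1)] e gD(1) by simp
  then have ge: "g e = \<one>\<^bsub>C\<^esub>"
    using C.Units_l_cancel[OF unit, of "g e" "\<one>\<^bsub>C\<^esub>"] gD(1)[OF e(1)] by simp
  have g_cong: "g a = g b" if "a \<in> carrier A" "b \<in> carrier A" "f a = f b" for a b
    using arg_cong[OF ker[OF that], of g] that e gD by (simp add: ge)
  \<comment> \<open>Any preimage under \<open>f\<close> would do: \<open>g_cong\<close> makes the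
    value independent of the choice.\<close>
  define h where "h = (\<lambda>x\<in>carrier B. g (inv_into (carrier A) f x))"
  have hf: "h (f a) = g a" if "a \<in> carrier A" for a
  proof -
    have "f a \<in> f ` carrier A" using that by blast
    then have "g (inv_into (carrier A) f (f a)) = g a"
      using that by (intro g_cong) (auto simp: inv_into_into f_inv_into_f)
    then show ?thesis using that fD(1) by (simp add: h_def)
  qed
  have obt: "\<exists>a\<in>carrier A. x = f a" if "x \<in> carrier B" for x using surj that by auto
  have "h \<in> ring_hom B C"
  proof (rule ring_hom_memI)
    fix x y assume "x \<in> carrier B" "y \<in> carrier B"
    then obtain a b where ab: "a \<in> carrier A" "x = f a" "b \<in> carrier A" "y = f b" using obt by meson
    show "h (x \<otimes>\<^bsub>B\<^esub> y) = h x \<otimes>\<^bsub>C\<^esub> h y"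
      using hf[of "a \<otimes>\<^bsub>A\<^esub> b"] ab by (simp add: fD(2) gD(2) hf)
    show "h (x \<oplus>\<^bsub>B\<^esub> y) = h x \<oplus>\<^bsub>C\<^esub> h y"
      using hf[of "a \<oplus>\<^bsub>A\<^esub> b"] ab by (simp add: fD(3) gD(3) hf)
  next
    show "h x \<in> carrier C" if "x \<in> carrier B" for x using obt[OF that] gD(1) by (auto simp: hf)
    show "h \<one>\<^bsub>B\<^esub> = \<one>\<^bsub>C\<^esub>" using hf[OF e(1)] by (simp add: fe ge)
  qed
  then have h: "h \<in> rhom B C" using B.cring_axioms C.cring_axioms by (simp add: rhom_def h_def)
  have comp: "compose (carrier A) h f = g"
    using compose_rhom[OF f h] g by (rule rhom_eqI) (simp add: compose_def hf)
  show "\<exists>!h. h \<in> rhom B C \<and> compose (carrier A) h f = g"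
    using h comp rhom_eq_on_surj[OF _ _ surj, of _ C] by blast
qed

lemma is_sheafD:
  assumes "is_sheaf cov V" "cring A" "cov A \<U>" "\<forall>(B, f) \<in> \<U>. s (B, f) \<in> pts V B"
    and "\<forall>(B, f) \<in> \<U>. \<forall>(B', f') \<in> \<U>. \<forall>C. \<forall>g \<in> rhom B C. \<forall>g' \<in> rhom B' C.
      compose (carrier A) g f = compose (carrier A) g' f' \<longrightarrow>
      act V B C g (s (B, f)) = act V B' C g' (s (B', f'))"
  shows "\<exists>!x. x \<in> pts V A \<and> (\<forall>(B, f) \<in> \<U>. act V A B f x = s (B, f))"
  using assms(1)[unfolded is_sheaf_def, THEN conjunct2, THEN spec, THEN spec, THEN spec, of A \<U> s,
    THEN mp, OF conjI, OF assms(2) conjI, OF assms(3) conjI, OF assms(4,5)] .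

text \<open>The zero ring is covered by the empty family.\<close>

lemma sheaf_zero_ring_unique:
  assumes V: "is_sheaf zariski_cover V" and C: "cring C" "\<one>\<^bsub>C\<^esub> = \<zero>\<^bsub>C\<^esub>"
    and xy: "x \<in> pts V C" "y \<in> pts V C"
  shows "x = y"
proof -
  interpret cring C by fact
  interpret I: ideal "genideal C {}" C by (rule genideal_ideal) simp
  have "\<one>\<^bsub>C\<^esub> \<in> genideal C {}" using I.zero_closed C(2) by simp
  then have "genideal C {} = carrier C" by (rule I.one_imp_carrier)
  then have "zariski_cover C {}" by (simp add: zariski_cover_def)
  then have "\<exists>!x. x \<in> pts V C" using is_sheafD[OF V C(1), of "{}"] by simp
  then show ?thesis using xy by blast
qed

text \<open>The cover consists of two disjoint pieces, so compatibility is automatic. On a single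
  piece, two maps that agree after a surjection are equal. A ring under both pieces receives
  \<open>e\<close> both as 1 and as 0, so it is the zero ring, over which a sheaf has at most one
  point.\<close>

lemma glue_points:
  assumes V: "is_sheaf zariski_cover V" and A: "cring A"
    and loc: "is_localization A e B f" "is_localization A e' B' f'"
    and surj: "f ` carrier A = carrier B" "f' ` carrier A = carrier B'"
    and vals: "f e = \<one>\<^bsub>B\<^esub>" "f' e = \<zero>\<^bsub>B'\<^esub>" "f' e' = \<one>\<^bsub>B'\<^esub>" "\<one>\<^bsub>B'\<^esub> \<noteq> \<zero>\<^bsub>B'\<^esub>"
    and ee': "e \<oplus>\<^bsub>A\<^esub> e' = \<one>\<^bsub>A\<^esub>"
    and y: "y \<in> pts V B" and y': "y' \<in> pts V B'"
  obtains x where "x \<in> pts V A" "act V A B f x = y" "act V A B' f' x = y'"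
proof -
  interpret A: cring A by fact
  define \<U> where "\<U> = {(B, f), (B', f')}"
  define s where "s p = (if p = (B', f') then y' else y)" for p
  have f: "f \<in> rhom A B" "f' \<in> rhom A B'" and e: "e \<in> carrier A" "e' \<in> carrier A"
    using loc by (auto simp: is_localization_def)
  interpret B: cring B using rhom_cring(2)[OF f(1)] .
  interpret B': cring B' using rhom_cring(2)[OF f(2)] .
  \<comment> \<open>The two pieces must be different members of the cover for \<open>s\<close> to
    take both prescribed values. If they coincided, the image of \<open>e\<close> would give 1 = 0
    in \<open>B'\<close>.\<close>
  have ne: "(B, f) \<noteq> (B', f')" using vals by auto
  have "is_functor V" using V by (simp add: is_sheaf_def)
  note act_closed = is_functor_act_closed[OF this]
  have "zariski_cover A \<U>"
    unfolding zariski_cover_def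
  proof (intro conjI exI)
    let ?a = "\<lambda>p. if p = (B', f') then e' else e"
    show "finite \<U>" by (simp add: \<U>_def)
    show "\<forall>(B, f)\<in>\<U>. is_localization A (?a (B, f)) B f" using loc ne by (auto simp: \<U>_def)
    have im: "?a ` \<U> = {e, e'}" using ne by (auto simp: \<U>_def)
    have "ideal (genideal A {e, e'}) A" using e by (intro A.genideal_ideal) auto
    then interpret ideal "genideal A {e, e'}" A .
    have "e \<in> genideal A {e, e'}" "e' \<in> genideal A {e, e'}"
      using A.genideal_self[of "{e, e'}"] e by auto
    then have "\<one>\<^bsub>A\<^esub> \<in> genideal A {e, e'}" using a_closed ee' by metis
    then show "genideal A (?a ` \<U>) = carrier A" unfolding im by (rule one_imp_carrier)
  qed
  moreover have "\<forall>(B, f)\<in>\<U>. s (B, f) \<in> pts V B" using y y' ne by (auto simp: \<U>_def s_def)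
  moreover have "\<forall>(B, f)\<in>\<U>. \<forall>(B', f')\<in>\<U>. \<forall>C. \<forall>g\<in>rhom B C. \<forall>g'\<in>rhom B' C.
      compose (carrier A) g f = compose (carrier A) g' f' \<longrightarrow>
      act V B C g (s (B, f)) = act V B' C g' (s (B', f'))"
  proof -
    have same: "g = g'" if "g \<in> rhom B C" "g' \<in> rhom B C" "compose (carrier A) g f = compose (carrier A) g' f" for g g' C
      using rhom_eq_on_surj[OF that(1,2) surj(1) that(3)] .
    have same': "g = g'" if "g \<in> rhom B' C" "g' \<in> rhom B' C" "compose (carrier A) g f' = compose (carrier A) g' f'" for g g' C
      using rhom_eq_on_surj[OF that(1,2) surj(2) that(3)] .
    have diff: "act V B C g y = act V B' C g' y'"
      if g: "g \<in> rhom B C" "g' \<in> rhom B' C" and eq: "compose (carrier A) g f = compose (carrier A) g' f'" for g g' C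
    proof (rule sheaf_zero_ring_unique[OF V])
      show "cring C" using rhom_cring(2)[OF g(1)] .
      show "\<one>\<^bsub>C\<^esub> = \<zero>\<^bsub>C\<^esub>"
        using fun_cong[OF eq, of e] e vals rhomD(4)[OF g(1)] rhomD(5)[OF g(2)] by (simp add: compose_def)
    qed (use act_closed g y y' in auto)
    show ?thesis
      unfolding \<U>_def using ne
      by (auto simp: s_def dest: same same' diff diff[symmetric, OF _ _ sym])
  qed
  ultimately have "\<exists>!x. x \<in> pts V A \<and> (\<forall>(B, f) \<in> \<U>. act V A B f x = s (B, f))"
    by (rule is_sheafD[OF V A])
  then obtain x where "x \<in> pts V A" "\<forall>(B, f) \<in> \<U>. act V A B f x = s (B, f)" by blast
  then show thesis using that ne by (auto simp: \<U>_def s_def)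
qed

section \<open>The factor ring cut out by an idempotent\<close>

text \<open>For idempotent \<open>e\<close> this is the quotient of \<open>A\<close> by the ideal
  generated by 1 - \<open>e\<close>, realised inside \<open>A\<close>. A quotient by cosets would
  have carrier in \<open>'r set\<close>, where a functor on rings of type \<open>'r ring\<close>
  cannot be evaluated.\<close>

definition corner_ring :: "'r ring \<Rightarrow> 'r \<Rightarrow> 'r ring" where
  "corner_ring A e = A\<lparr>carrier := (\<lambda>a. e \<otimes>\<^bsub>A\<^esub> a) ` carrier A, one := e\<rparr>"

lemma corner_ring_simps [simp]:
  "carrier (corner_ring A e) = (\<lambda>a. e \<otimes>\<^bsub>A\<^esub> a) ` carrier A"
  "\<one>\<^bsub>corner_ring A e\<^esub> = e"
  "x \<otimes>\<^bsub>corner_ring A e\<^esub> y = x \<otimes>\<^bsub>A\<^esub> y"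
  "x \<oplus>\<^bsub>corner_ring A e\<^esub> y = x \<oplus>\<^bsub>A\<^esub> y"
  "\<zero>\<^bsub>corner_ring A e\<^esub> = \<zero>\<^bsub>A\<^esub>"
  by (simp_all add: corner_ring_def)

text \<open>Describing the ideal as the fixed points of multiplication by \<open>e\<close> makes the
  closure properties equational. It replaces the image form of the carrier, which is therefore
  removed from the simplifier where this rule is used.\<close>

lemma corner_mem_iff:
  assumes A: "cring A" and e: "e \<in> carrier A" "e \<otimes>\<^bsub>A\<^esub> e = e"
  shows "x \<in> carrier (corner_ring A e) \<longleftrightarrow> x \<in> carrier A \<and> e \<otimes>\<^bsub>A\<^esub> x = x"
proof -
  interpret A: cring A by fact
  show ?thesis
  proof
    assume "x \<in> carrier (corner_ring A e)"
    then obtain a where a: "a \<in> carrier A" "x = e \<otimes>\<^bsub>A\<^esub> a" by auto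
    then show "x \<in> carrier A \<and> e \<otimes>\<^bsub>A\<^esub> x = x" using e by (simp add: A.m_assoc[symmetric])
  next
    assume "x \<in> carrier A \<and> e \<otimes>\<^bsub>A\<^esub> x = x"
    then show "x \<in> carrier (corner_ring A e)" by (metis corner_ring_simps(1) image_eqI)
  qed
qed

lemma cring_corner_ring:
  assumes A: "cring A" and e: "e \<in> carrier A" "e \<otimes>\<^bsub>A\<^esub> e = e"
  shows "cring (corner_ring A e)"
proof -
  interpret A: cring A by fact
  note mem = corner_mem_iff[OF A e]
  have mult: "e \<otimes>\<^bsub>A\<^esub> (x \<otimes>\<^bsub>A\<^esub> y) = x \<otimes>\<^bsub>A\<^esub> y"
    if "x \<in> carrier A" "y \<in> carrier A" "e \<otimes>\<^bsub>A\<^esub> x = x" for x y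
    using that e by (simp add: A.m_assoc[symmetric])
  have neg: "\<exists>y\<in>carrier (corner_ring A e). y \<oplus>\<^bsub>A\<^esub> x = \<zero>\<^bsub>A\<^esub>"
    if "x \<in> carrier (corner_ring A e)" for x
    using that e unfolding mem by (intro bexI[of _ "\<ominus>\<^bsub>A\<^esub> x"]) (auto simp: mem A.r_minus A.l_neg simp del: corner_ring_simps(1))
  show ?thesis
  proof (rule cringI)
    show "abelian_group (corner_ring A e)"
      by (rule abelian_groupI; (unfold corner_ring_simps(2-))?)
        (use e neg in \<open>auto simp: mem A.a_ac A.r_distr simp del: corner_ring_simps(1)\<close>)
    show "comm_monoid (corner_ring A e)"
      by (rule comm_monoidI)
        (use e in \<open>auto simp: mem mult A.m_ac simp del: corner_ring_simps(1)\<close>)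
    show "(x \<oplus>\<^bsub>corner_ring A e\<^esub> y) \<otimes>\<^bsub>corner_ring A e\<^esub> z =
        x \<otimes>\<^bsub>corner_ring A e\<^esub> z \<oplus>\<^bsub>corner_ring A e\<^esub> y \<otimes>\<^bsub>corner_ring A e\<^esub> z"
      if "x \<in> carrier (corner_ring A e)" "y \<in> carrier (corner_ring A e)"
        "z \<in> carrier (corner_ring A e)" for x y z
      using that unfolding mem by (simp add: A.l_distr)
  qed
qed

lemma corner_proj_rhom:
  assumes A: "cring A" and e: "e \<in> carrier A" "e \<otimes>\<^bsub>A\<^esub> e = e"
  shows "(\<lambda>a\<in>carrier A. e \<otimes>\<^bsub>A\<^esub> a) \<in> rhom A (corner_ring A e)"
proof -
  interpret A: cring A by fact
  have "e \<otimes>\<^bsub>A\<^esub> (a \<otimes>\<^bsub>A\<^esub> b) = (e \<otimes>\<^bsub>A\<^esub> a) \<otimes>\<^bsub>A\<^esub> (e \<otimes>\<^bsub>A\<^esub> b)"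
    if "a \<in> carrier A" "b \<in> carrier A" for a b
  proof -
    have "(e \<otimes>\<^bsub>A\<^esub> a) \<otimes>\<^bsub>A\<^esub> (e \<otimes>\<^bsub>A\<^esub> b) = (e \<otimes>\<^bsub>A\<^esub> e) \<otimes>\<^bsub>A\<^esub> (a \<otimes>\<^bsub>A\<^esub> b)"
      using that e(1) by (simp add: A.m_ac)
    then show ?thesis using e by simp
  qed
  then have "(\<lambda>a\<in>carrier A. e \<otimes>\<^bsub>A\<^esub> a) \<in> ring_hom A (corner_ring A e)"
    using e by (intro ring_hom_memI) (simp_all add: A.r_distr)
  then show ?thesis
    using cring_corner_ring[OF A e] A by (simp add: rhom_def)
qed

section \<open>Adelic points\<close>

definition adele_proj :: "'r completions \<Rightarrow> 'r place \<Rightarrow> 'r \<Rightarrow> 'r" where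
  "adele_proj D w = (\<lambda>a\<in>carrier (adeles D). coord D a w)"

lemma component_eq: "component V D P w = act V (adeles D) (cfield D w) (adele_proj D w) P"
  by (simp add: component_def adele_proj_def)

lemma completionsD:
  "completions_of K D \<Longrightarrow> w \<in> places K \<Longrightarrow> field (cfield D w)"
  "completions_of K D \<Longrightarrow> w \<in> places K \<Longrightarrow> cemb D w \<in> rhom K (cfield D w)"
  by (simp_all add: completions_of_def is_completion_def)

lemma adele_proj_rhom:
  assumes D: "completions_of K D" and w: "w \<in> places K"
  shows "adele_proj D w \<in> rhom (adeles D) (cfield D w)"
proof -
  have iso: "coord D \<in> ring_iso (adeles D) (restricted_product K D)" and A: "cring (adeles D)"
    using D by (auto simp: completions_of_def)
  interpret A: cring "adeles D" by fact
  have "adele_proj D w \<in> ring_hom (adeles D) (cfield D w)"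
  proof (rule ring_hom_memI)
    show "adele_proj D w x \<in> carrier (cfield D w)" if "x \<in> carrier (adeles D)" for x
      using ring_iso_memE(1)[OF iso that] that w by (auto simp: restricted_product_def adele_proj_def)
  qed (use w in \<open>simp_all add: adele_proj_def ring_iso_memE(2-4)[OF iso] restricted_product_def\<close>)
  then show ?thesis
    using A field.axioms(1)[OF completionsD(1)[OF D w]] by (simp add: rhom_def domain_def adele_proj_def)
qed

text \<open>Reduces identities between adeles, in particular those saying that an element is
  idempotent, to identities in each completion.\<close>

lemma adele_eqI:
  assumes D: "completions_of K D" and ab: "a \<in> carrier (adeles D)" "b \<in> carrier (adeles D)"
    and eq: "\<And>w. w \<in> places K \<Longrightarrow> adele_proj D w a = adele_proj D w b"
  shows "a = b"
proof -
  have iso: "coord D \<in> ring_iso (adeles D) (restricted_product K D)"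
    using D by (auto simp: completions_of_def)
  have "coord D x \<in> extensional (places K)" if "x \<in> carrier (adeles D)" for x
    using ring_iso_memE(1)[OF iso that] by (auto simp: restricted_product_def PiE_def)
  then have "coord D a = coord D b"
    using ab eq by (intro extensionalityI[of _ "places K"]) (auto simp: adele_proj_def)
  then show ?thesis
    using ring_iso_memE(5)[OF iso] ab by (auto simp: bij_betw_def inj_on_def)
qed

text \<open>The family with \<open>x\<close> at \<open>v\<close> and 0 elsewhere satisfies the
  finiteness condition, since only \<open>v\<close> can carry an absolute value above 1. With
  \<open>x\<close> = 1 it yields the idempotent of the factor at \<open>v\<close>; with arbitrary
  \<open>x\<close> it shows that the projection to that factor is surjective.\<close>

lemma adele_supported_at:
  assumes D: "completions_of K D" and v: "v \<in> places K" and x: "x \<in> carrier (cfield D v)"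
  obtains a where "a \<in> carrier (adeles D)" "adele_proj D v a = x"
    "\<And>w. w \<in> places K \<Longrightarrow> w \<noteq> v \<Longrightarrow> adele_proj D w a = \<zero>\<^bsub>cfield D w\<^esub>"
proof -
  have iso: "coord D \<in> ring_iso (adeles D) (restricted_product K D)"
    using D by (auto simp: completions_of_def)
  let ?c = "\<lambda>w\<in>places K. if w = v then x else \<zero>\<^bsub>cfield D w\<^esub>"
  have zero: "\<zero>\<^bsub>cfield D w\<^esub> \<in> carrier (cfield D w)" "cabs D w \<zero>\<^bsub>cfield D w\<^esub> = 0" if "w \<in> places K" for w
  proof -
    interpret field "cfield D w" using completionsD(1)[OF D that] .
    show "\<zero>\<^bsub>cfield D w\<^esub> \<in> carrier (cfield D w)" by simp
    then show "cabs D w \<zero>\<^bsub>cfield D w\<^esub> = 0"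
      using D that by (simp add: completions_of_def is_completion_def absolute_value_def)
  qed
  have "{w \<in> places K. nonarchimedean (cfield D w) (cabs D w) \<and> cabs D w (?c w) > 1} \<subseteq> {v}"
    by (auto simp: zero(2) split: if_splits)
  then have "finite {w \<in> places K. nonarchimedean (cfield D w) (cabs D w) \<and> cabs D w (?c w) > 1}"
    by (rule finite_subset) simp
  then have "?c \<in> carrier (restricted_product K D)"
    using x by (auto simp: restricted_product_def zero(1))
  then have "?c \<in> coord D ` carrier (adeles D)"
    using ring_iso_memE(5)[OF iso] by (simp only: bij_betw_def)
  then obtain a where "?c = coord D a" "a \<in> carrier (adeles D)" by (rule imageE)
  then have "a \<in> carrier (adeles D)" "coord D a = ?c" by simp_all
  then show thesis
    using v by (intro that[of a]) (simp_all add: adele_proj_def)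
qed

lemma component_local_points:
  assumes V: "is_functor V" and str: "nat_trans V (spec K) (str V)"
    and D: "completions_of K D" and w: "w \<in> places K" and P: "P \<in> adelic_points K V D"
  shows "component V D P w \<in> local_points V D w"
proof -
  have P': "P \<in> pts V (adeles D)"
      "\<forall>x \<in> carrier K. coord D (str V (adeles D) P x) = (\<lambda>w\<in>places K. cemb D w x)"
    using P by (auto simp: adelic_points_def)
  note pr = adele_proj_rhom[OF D w]
  have strP: "str V (adeles D) P \<in> rhom K (adeles D)"
    using nat_transD(1)[OF str rhom_cring(1)[OF pr] P'(1)] by (simp add: spec_def)
  have "str V (cfield D w) (component V D P w) = compose (carrier K) (adele_proj D w) (str V (adeles D) P)"
    using nat_transD(2)[OF str pr P'(1)] by (simp add: component_eq spec_def)
  also have "\<dots> = cemb D w"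
  proof (rule rhom_eqI)
    show "compose (carrier K) (adele_proj D w) (str V (adeles D) P) x = cemb D w x"
      if "x \<in> carrier K" for x
      using P'(2) that w rhomD(1)[OF strP that] by (simp add: compose_def adele_proj_def)
  qed (use compose_rhom[OF strP pr] completionsD(2)[OF D w] in auto)
  finally show ?thesis
    using is_functor_act_closed[OF V pr P'(1)] by (simp add: local_points_def kpoints_def component_eq)
qed

text \<open>Converse to the preceding lemma. The structure map sends each element of
  \<open>K\<close> to an adele, and an adele is determined by its coordinates, which are the
  structure maps of the components.\<close>

lemma adelic_pointsI:
  assumes str: "nat_trans V (spec K) (str V)" and D: "completions_of K D"
    and P: "P \<in> pts V (adeles D)" and local: "\<And>w. w \<in> places K \<Longrightarrow> component V D P w \<in> local_points V D w"
  shows "P \<in> adelic_points K V D"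
proof -
  have A: "cring (adeles D)" and iso: "coord D \<in> ring_iso (adeles D) (restricted_product K D)"
    using D by (auto simp: completions_of_def)
  have strP: "str V (adeles D) P \<in> rhom K (adeles D)"
    using nat_transD(1)[OF str A P] by (simp add: spec_def)
  have "coord D (str V (adeles D) P x) = (\<lambda>w\<in>places K. cemb D w x)" if x: "x \<in> carrier K" for x
  proof (rule extensionalityI[of _ "places K"])
    show "coord D (str V (adeles D) P x) \<in> extensional (places K)"
      using ring_iso_memE(1)[OF iso rhomD(1)[OF strP x]] by (auto simp: restricted_product_def PiE_def)
    fix w assume w: "w \<in> places K"
    have "cemb D w = compose (carrier K) (adele_proj D w) (str V (adeles D) P)"
      using nat_transD(2)[OF str adele_proj_rhom[OF D w] P] local[OF w]
      by (simp add: component_eq spec_def local_points_def kpoints_def)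
    then have "cemb D w x = adele_proj D w (str V (adeles D) P x)"
      using x by (simp add: compose_def)
    then show "coord D (str V (adeles D) P x) w = (\<lambda>w\<in>places K. cemb D w x) w"
      using w rhomD(1)[OF strP x] by (simp add: adele_proj_def)
  qed simp
  then show ?thesis using P by (simp add: adelic_points_def)
qed

text \<open>The adele ring is the product of \<open>K\<^sub>v\<close> and the corner ring of the idempotent \<open>c\<close> that
  vanishes exactly at \<open>v\<close>. The corner ring stands in for the adeles away from \<open>v\<close>.\<close>

lemma replace_component:
  assumes V: "is_sheaf zariski_cover V" and str: "nat_trans V (spec K) (str V)"
    and D: "completions_of K D" and v: "v \<in> places K"
    and P: "P \<in> adelic_points K V D" and Q: "Q \<in> local_points V D v"
  obtains P' where "P' \<in> adelic_points K V D" "component V D P' v = Q"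
    "\<And>w. w \<in> places K \<Longrightarrow> w \<noteq> v \<Longrightarrow> component V D P' w = component V D P w"
proof -
  let ?A = "adeles D"
  have A: "cring ?A" using D by (simp add: completions_of_def)
  interpret A: cring ?A by fact
  interpret Kv: field "cfield D v" using completionsD(1)[OF D v] .
  have Vf: "is_functor V" using V by (simp add: is_sheaf_def)
  have PA: "P \<in> pts V ?A" using P by (simp add: adelic_points_def)
  note pr = adele_proj_rhom[OF D]
  obtain e where e: "e \<in> carrier ?A" "adele_proj D v e = \<one>\<^bsub>cfield D v\<^esub>"
    "\<And>w. w \<in> places K \<Longrightarrow> w \<noteq> v \<Longrightarrow> adele_proj D w e = \<zero>\<^bsub>cfield D w\<^esub>"
    using adele_supported_at[OF D v Kv.one_closed] by metis
  define c where "c = \<one>\<^bsub>?A\<^esub> \<ominus>\<^bsub>?A\<^esub> e"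
  have c: "c \<in> carrier ?A" and ce: "c \<oplus>\<^bsub>?A\<^esub> e = \<one>\<^bsub>?A\<^esub>"
    using e(1) by (simp_all add: c_def A.minus_eq A.a_assoc A.l_neg)
  have sum: "adele_proj D w c \<oplus>\<^bsub>cfield D w\<^esub> adele_proj D w e = \<one>\<^bsub>cfield D w\<^esub>" if "w \<in> places K" for w
    using rhomD(3)[OF pr[OF that] c e(1)] rhomD(4)[OF pr[OF that]] ce by simp
  have cv: "adele_proj D v c = \<zero>\<^bsub>cfield D v\<^esub>"
    using sum[OF v] rhomD(1)[OF pr[OF v] c] by (simp add: e)
  have cw: "adele_proj D w c = \<one>\<^bsub>cfield D w\<^esub>" if "w \<in> places K" "w \<noteq> v" for w
  proof -
    interpret Kw: field "cfield D w" using completionsD(1)[OF D that(1)] .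
    show ?thesis using sum[OF that(1)] rhomD(1)[OF pr[OF that(1)] c] by (simp add: e that)
  qed
  \<comment> \<open>Multiplication by \<open>e\<close> forgets all coordinates except the one at
    \<open>v\<close>. This is the kernel condition needed to see the projection to the completion at
    \<open>v\<close> as a localisation; with \<open>b\<close> = 1 it also gives the idempotence of
    \<open>e\<close>.\<close>
  have ee: "e \<otimes>\<^bsub>?A\<^esub> a = e \<otimes>\<^bsub>?A\<^esub> b"
    if "a \<in> carrier ?A" "b \<in> carrier ?A" "adele_proj D v a = adele_proj D v b" for a b
  proof (rule adele_eqI[OF D])
    fix w assume w: "w \<in> places K"
    interpret Kw: field "cfield D w" using completionsD(1)[OF D w] .
    show "adele_proj D w (e \<otimes>\<^bsub>?A\<^esub> a) = adele_proj D w (e \<otimes>\<^bsub>?A\<^esub> b)"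
      unfolding rhomD(2)[OF pr[OF w] e(1) that(1)] rhomD(2)[OF pr[OF w] e(1) that(2)]
      using that(3) e(3)[OF w] rhomD(1)[OF pr[OF w] that(1)] rhomD(1)[OF pr[OF w] that(2)]
      by (cases "w = v") simp_all
  qed (use that e in auto)
  have e_idem: "e \<otimes>\<^bsub>?A\<^esub> e = e"
    using ee[OF e(1) A.one_closed] rhomD(4)[OF pr[OF v]] e by simp
  have c_idem: "c \<otimes>\<^bsub>?A\<^esub> c = c"
  proof (rule adele_eqI[OF D])
    fix w assume w: "w \<in> places K"
    interpret Kw: field "cfield D w" using completionsD(1)[OF D w] .
    show "adele_proj D w (c \<otimes>\<^bsub>?A\<^esub> c) = adele_proj D w c"
      unfolding rhomD(2)[OF pr[OF w] c c] using w by (cases "w = v") (simp_all add: cv cw)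
  qed (use c in auto)
  let ?C = "corner_ring ?A c" and ?f = "\<lambda>a\<in>carrier ?A. c \<otimes>\<^bsub>?A\<^esub> a"
  note f = corner_proj_rhom[OF A c c_idem]
  have surj_f: "?f ` carrier ?A = carrier ?C" by auto
  have surj_v: "adele_proj D v ` carrier ?A = carrier (cfield D v)"
  proof
    show "carrier (cfield D v) \<subseteq> adele_proj D v ` carrier ?A"
    proof
      fix x assume "x \<in> carrier (cfield D v)"
      then show "x \<in> adele_proj D v ` carrier ?A"
        by (rule adele_supported_at[OF D v]) auto
    qed
  qed (use rhomD(1)[OF pr[OF v]] in auto)
  have loc: "is_localization ?A c ?C ?f"
    using f surj_f c c_idem by (rule is_localization_idempotent) (use c c_idem in auto)
  have loc_v: "is_localization ?A e (cfield D v) (adele_proj D v)"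
    using pr[OF v] surj_v e(1) e_idem e(2) ee by (rule is_localization_idempotent)
  \<comment> \<open>The completion at \<open>v\<close> takes the second position because
    \<open>glue_points\<close> asks for a nonzero ring there, and a field is one.\<close>
  obtain P' where P': "P' \<in> pts V ?A" "act V ?A ?C ?f P' = act V ?A ?C ?f P"
      "act V ?A (cfield D v) (adele_proj D v) P' = Q"
  proof (rule glue_points[OF V A loc loc_v surj_f surj_v _ cv e(2) _ ce])
    show "act V ?A ?C ?f P \<in> pts V ?C" using is_functor_act_closed[OF Vf f PA] .
    show "Q \<in> pts V (cfield D v)" using Q by (simp add: local_points_def kpoints_def)
  qed (use c c_idem in auto)
  have comp_v: "component V D P' v = Q" using P'(3) by (simp add: component_eq)
  have comp_w: "component V D P' w = component V D P w" if w: "w \<in> places K" "w \<noteq> v" for w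
  proof -
    interpret Kw: field "cfield D w" using completionsD(1)[OF D w(1)] .
    note prw = rhomD[OF pr[OF w(1)]]
    note mem = corner_mem_iff[OF A c c_idem]
    \<comment> \<open>For \<open>w\<close> different from \<open>v\<close> the projection sends
      \<open>c\<close> to 1, so it factors through the corner ring. The component at
      \<open>w\<close> hence sees a point only through its image over the corner ring, where
      \<open>P'\<close> and \<open>P\<close> agree.\<close>
    let ?h = "\<lambda>a\<in>carrier ?C. adele_proj D w a"
    have "?h \<in> ring_hom ?C (cfield D w)"
      using prw cring.cring_simprules(5)[OF cring_corner_ring[OF A c c_idem]]
        cring.cring_simprules(1)[OF cring_corner_ring[OF A c c_idem]]
        cring.cring_simprules(6)[OF cring_corner_ring[OF A c c_idem]]
      by (intro ring_hom_memI) (simp_all add: mem cw[OF w] del: corner_ring_simps(1))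
    then have h: "?h \<in> rhom ?C (cfield D w)"
      using cring_corner_ring[OF A c c_idem] Kw.is_cring by (simp add: rhom_def)
    have fac: "compose (carrier ?A) ?h ?f = adele_proj D w"
      using compose_rhom[OF f h] pr[OF w(1)]
    proof (rule rhom_eqI)
      show "compose (carrier ?A) ?h ?f a = adele_proj D w a" if "a \<in> carrier ?A" for a
        using that prw(1)[OF that] by (simp add: compose_def prw(2)[OF c] cw[OF w])
    qed
    have "component V D R w = act V ?C (cfield D w) ?h (act V ?A ?C ?f R)" if "R \<in> pts V ?A" for R
    proof -
      have "act V ?A (cfield D w) (compose (carrier ?A) ?h ?f) R =
          act V ?C (cfield D w) ?h (act V ?A ?C ?f R)"
        using Vf f h that unfolding is_functor_def by blast
      then show ?thesis unfolding fac component_eq .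
    qed
    then show ?thesis using P'(1,2) PA by simp
  qed
  have "component V D P' w \<in> local_points V D w" if "w \<in> places K" for w
    using component_local_points[OF Vf str D that P] comp_v comp_w[OF that] Q by (cases "w = v") auto
  then have "P' \<in> adelic_points K V D" by (rule adelic_pointsI[OF str D P'(1)])
  then show thesis using that comp_v comp_w by blast
qed

section \<open>Sums of local invariants\<close>

lemma comm_group_QZ: "comm_group QZ"
proof -
  have G: "comm_group rat_additive"
    by (rule comm_groupI) (auto simp: rat_additive_def intro: exI[of _ "- _"])
  have inv: "inv\<^bsub>rat_additive\<^esub> x = - x" for x
    by (rule group.inv_equality[OF comm_group.axioms(2)[OF G]]) (simp_all add: rat_additive_def)
  have "subgroup \<int> rat_additive"
    by (rule group.subgroupI[OF comm_group.axioms(2)[OF G]])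
      (simp add: rat_additive_def, blast intro: Ints_0, simp add: inv, simp add: rat_additive_def)
  then show ?thesis unfolding QZ_def by (rule comm_group.abelian_FactGroup[OF G])
qed

interpretation QZ: comm_group QZ by (rule comm_group_QZ)

lemma local_inv_at_hom:
  assumes V: "is_functor V" and I: "Gm_injective_resolution I"
    and iv: "\<forall>w \<in> places K. local_invariant_map I (cfield D w) (cabs D w) (iv w)"
    and w: "w \<in> places K" and Q: "Q \<in> local_points V D w"
  shows "(\<lambda>\<A>. local_inv_at I V D iv w \<A> Q) \<in> hom (Br I V) QZ"
proof -
  have "Q \<in> pts V (cfield D w)" using Q by (simp add: local_points_def kpoints_def)
  note ev = Br_eval_hom[OF V I this]
  have "iv w \<in> hom (Br I (spec (cfield D w))) QZ" using iv w by (simp add: local_invariant_map_def)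
  from hom_compose[OF ev this] show ?thesis by (simp add: local_inv_at_def[abs_def] comp_def)
qed

text \<open>Places outside the support contribute the unit. Sums with different supports can thus be
  compared over one common finite index set.\<close>

lemma inv_sum_eq_finprod:
  assumes "\<And>w. w \<in> T \<Longrightarrow> local_inv_at I V D iv w \<A> (component V D P w) \<in> carrier QZ"
    and "finite T" "inv_support I K V D iv \<A> P \<subseteq> T" "T \<subseteq> places K"
  shows "inv_sum I K V D iv \<A> P = finprod QZ (\<lambda>w. local_inv_at I V D iv w \<A> (component V D P w)) T"
  unfolding inv_sum_def
  by (rule QZ.finprod_mono_neutral_cong_left) (use assms in \<open>auto simp: inv_support_def\<close>)

lemma inv_sum_closed:
  assumes "\<And>w. w \<in> places K \<Longrightarrow> local_inv_at I V D iv w \<A> (component V D P w) \<in> carrier QZ"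
  shows "inv_sum I K V D iv \<A> P \<in> carrier QZ"
  unfolding inv_sum_def by (rule QZ.finprod_closed) (use assms in \<open>auto simp: inv_support_def\<close>)

lemma inv_sum_mult:
  assumes hom: "\<And>w. w \<in> places K \<Longrightarrow>
      (\<lambda>\<A>. local_inv_at I V D iv w \<A> (component V D P w)) \<in> hom (Br I V) QZ"
    and fin: "\<And>\<A>. \<A> \<in> carrier (Br I V) \<Longrightarrow> finite (inv_support I K V D iv \<A> P)"
    and \<A>: "\<A> \<in> carrier (Br I V)" "\<A>' \<in> carrier (Br I V)" "\<A> \<otimes>\<^bsub>Br I V\<^esub> \<A>' \<in> carrier (Br I V)"
  shows "inv_sum I K V D iv (\<A> \<otimes>\<^bsub>Br I V\<^esub> \<A>') P =
    inv_sum I K V D iv \<A> P \<otimes>\<^bsub>QZ\<^esub> inv_sum I K V D iv \<A>' P"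
proof -
  \<comment> \<open>The third support lies in the union of the other two; listing it makes its
    inclusion in \<open>T\<close> immediate.\<close>
  define T where "T = inv_support I K V D iv \<A> P \<union> inv_support I K V D iv \<A>' P \<union>
    inv_support I K V D iv (\<A> \<otimes>\<^bsub>Br I V\<^esub> \<A>') P"
  let ?l = "\<lambda>\<A> w. local_inv_at I V D iv w \<A> (component V D P w)"
  have T: "finite T" "T \<subseteq> places K" using fin \<A> by (auto simp: T_def inv_support_def)
  have closed: "?l \<C> w \<in> carrier QZ" if "\<C> \<in> carrier (Br I V)" "w \<in> T" for \<C> w
    using hom_in_carrier[OF hom that(1)] T that(2) by blast
  have eq: "inv_sum I K V D iv \<C> P = finprod QZ (?l \<C>) T"
    if "\<C> \<in> carrier (Br I V)" "inv_support I K V D iv \<C> P \<subseteq> T" for \<C>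
    using closed[OF that(1)] T(1) that(2) T(2) by (rule inv_sum_eq_finprod)
  have mult: "?l (\<A> \<otimes>\<^bsub>Br I V\<^esub> \<A>') w = ?l \<A> w \<otimes>\<^bsub>QZ\<^esub> ?l \<A>' w" if "w \<in> T" for w
    using hom_mult[OF hom \<A>(1,2)] T(2) that by blast
  have "inv_sum I K V D iv (\<A> \<otimes>\<^bsub>Br I V\<^esub> \<A>') P = finprod QZ (?l (\<A> \<otimes>\<^bsub>Br I V\<^esub> \<A>')) T"
    by (rule eq) (use \<A> in \<open>auto simp: T_def\<close>)
  also have "\<dots> = finprod QZ (\<lambda>w. ?l \<A> w \<otimes>\<^bsub>QZ\<^esub> ?l \<A>' w) T"
    by (rule QZ.finprod_cong') (use closed \<A> mult in auto)
  also have "\<dots> = finprod QZ (?l \<A>) T \<otimes>\<^bsub>QZ\<^esub> finprod QZ (?l \<A>') T"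
    by (rule QZ.finprod_multf) (use closed \<A> in auto)
  also have "finprod QZ (?l \<A>) T = inv_sum I K V D iv \<A> P"
    by (rule eq[symmetric]) (use \<A> in \<open>auto simp: T_def\<close>)
  also have "finprod QZ (?l \<A>') T = inv_sum I K V D iv \<A>' P"
    by (rule eq[symmetric]) (use \<A> in \<open>auto simp: T_def\<close>)
  finally show ?thesis .
qed

lemma inv_sum_replace_component:
  assumes P: "\<And>w. w \<in> places K \<Longrightarrow> local_inv_at I V D iv w \<A> (component V D P w) \<in> carrier QZ"
    and P': "\<And>w. w \<in> places K \<Longrightarrow> local_inv_at I V D iv w \<A> (component V D P' w) \<in> carrier QZ"
    and fin: "finite (inv_support I K V D iv \<A> P)" "finite (inv_support I K V D iv \<A> P')"
    and v: "v \<in> places K"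
    and same: "\<And>w. w \<in> places K \<Longrightarrow> w \<noteq> v \<Longrightarrow> component V D P' w = component V D P w"
  shows "inv_sum I K V D iv \<A> P' = inv_sum I K V D iv \<A> P \<otimes>\<^bsub>QZ\<^esub>
    (local_inv_at I V D iv v \<A> (component V D P' v) \<otimes>\<^bsub>QZ\<^esub>
      inv\<^bsub>QZ\<^esub> local_inv_at I V D iv v \<A> (component V D P v))"
proof -
  \<comment> \<open>The place \<open>v\<close> is removed and then inserted again, because it may
    lie in one support, in both or in neither, while both sums must show a term at
    \<open>v\<close>.\<close>
  define T where "T = inv_support I K V D iv \<A> P \<union> inv_support I K V D iv \<A> P' - {v}"
  let ?l = "\<lambda>P w. local_inv_at I V D iv w \<A> (component V D P w)"
  have T: "finite T" "insert v T \<subseteq> places K" "v \<notin> T" using fin v by (auto simp: T_def inv_support_def)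
  define t where "t = finprod QZ (?l P) T"
  have t: "t \<in> carrier QZ" unfolding t_def by (rule QZ.finprod_closed) (use P T in auto)
  have "inv_sum I K V D iv \<A> P = finprod QZ (?l P) (insert v T)"
    by (rule inv_sum_eq_finprod) (use P T in \<open>auto simp: T_def\<close>)
  also have "\<dots> = ?l P v \<otimes>\<^bsub>QZ\<^esub> t"
    unfolding t_def using T P by (intro QZ.finprod_insert) auto
  finally have 1: "inv_sum I K V D iv \<A> P = ?l P v \<otimes>\<^bsub>QZ\<^esub> t" .
  have "inv_sum I K V D iv \<A> P' = finprod QZ (?l P') (insert v T)"
    by (rule inv_sum_eq_finprod) (use P' T in \<open>auto simp: T_def\<close>)
  also have "\<dots> = ?l P' v \<otimes>\<^bsub>QZ\<^esub> finprod QZ (?l P') T"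
    using T P' by (intro QZ.finprod_insert) auto
  also have "finprod QZ (?l P') T = t"
    unfolding t_def
  proof (rule QZ.finprod_cong')
    show "?l P' w = ?l P w" if "w \<in> T" for w
      using same[of w] that T by (metis insert_subset subsetD)
  qed (use P T in auto)
  finally have 2: "inv_sum I K V D iv \<A> P' = ?l P' v \<otimes>\<^bsub>QZ\<^esub> t" .
  define a b where "a = ?l P v" and "b = ?l P' v"
  have ab: "a \<in> carrier QZ" "b \<in> carrier QZ" using P P' v by (auto simp: a_def b_def)
  have "(a \<otimes>\<^bsub>QZ\<^esub> t) \<otimes>\<^bsub>QZ\<^esub> (b \<otimes>\<^bsub>QZ\<^esub> inv\<^bsub>QZ\<^esub> a) = (b \<otimes>\<^bsub>QZ\<^esub> t) \<otimes>\<^bsub>QZ\<^esub> (a \<otimes>\<^bsub>QZ\<^esub> inv\<^bsub>QZ\<^esub> a)"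
    using ab t QZ.inv_closed[OF ab(1)] by (simp only: QZ.m_ac QZ.m_closed)
  also have "\<dots> = b \<otimes>\<^bsub>QZ\<^esub> t" using ab t by simp
  finally show ?thesis unfolding 1 2 a_def b_def ..
qed

section \<open>Cancelling the sum of invariants by a change at one place\<close>

theorem proposition7p3:
  fixes K :: "'r ring" and V :: "('r, 'x) kscheme" and D :: "'r completions"
    and I :: "('r, 'i) resolution" and iv :: "('r, 'i) invariants"
    and B :: "('r ring \<Rightarrow> 'x \<Rightarrow> 'i) set set set" and v :: "'r place"
  assumes "number_field K"
    and "variety K V"
    and "completions_of K D"
    and "Gm_injective_resolution I"
    and "\<forall>w \<in> places K. local_invariant_map I (cfield D w) (cabs D w) (iv w)"
    and "inv_sum_well_defined I K V D iv"
    and "adelic_points K V D \<noteq> {}"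
    and "subgroup B (Br_mod_const I K V)"
    and "v \<in> places K"
    and "prolific I K V D iv B v"
  shows "\<not> brauer_manin_obstruction I K V D iv B"
proof -
  have V: "is_sheaf zariski_cover V" and str: "nat_trans V (spec K) (str V)"
    using assms(2) by (auto simp: variety_def)
  then have Vf: "is_functor V" by (simp add: is_sheaf_def)
  note D = assms(3) and I = assms(4) and v = assms(9)
  let ?G = "Br_mod_const I K V" and ?S = "inv_sum I K V D iv"
  interpret Br: comm_group "Br I V" unfolding Br_def by (rule comm_group_cohomology[OF Vf I])
  have BG: "\<beta> \<in> carrier ?G" if "\<beta> \<in> B" for \<beta> using subgroup.subset[OF assms(8)] that by blast
  have rep: "\<A> \<in> carrier (Br I V)" if "\<beta> \<in> B" "\<A> \<in> \<beta>" for \<beta> \<A>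
    using Br_mod_const_subset(1)[OF Vf I str BG[OF that(1)]] that(2) by blast
  have hom: "(\<lambda>\<A>. local_inv_at I V D iv w \<A> (component V D P w)) \<in> hom (Br I V) QZ"
    if "P \<in> adelic_points K V D" "w \<in> places K" for P w
    by (rule local_inv_at_hom[OF Vf I assms(5) that(2) component_local_points[OF Vf str D that(2,1)]])
  note closed = hom_in_carrier[OF hom]
  have fin: "finite (inv_support I K V D iv \<A> P)"
    if "P \<in> adelic_points K V D" "\<A> \<in> carrier (Br I V)" for P \<A>
    using assms(6) that by (auto simp: inv_sum_well_defined_def)
  obtain P0 where P0: "P0 \<in> local_points V D v"
    and prol: "\<forall>\<psi> \<in> hom (?G\<lparr>carrier := B\<rparr>) QZ. \<exists>Q \<in> local_points V D v. \<forall>\<beta> \<in> B. \<forall>\<A> \<in> \<beta>.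
      local_inv_at I V D iv v \<A> Q \<otimes>\<^bsub>QZ\<^esub> inv\<^bsub>QZ\<^esub> (local_inv_at I V D iv v \<A> P0) = \<psi> \<beta>"
    using assms(10)[unfolded prolific_def] by (elim bexE)
  \<comment> \<open>The base point \<open>P0\<close> comes with prolificness and need not be a
    component of \<open>P\<close>. Moving the component at \<open>v\<close> to \<open>P0\<close>
    makes the pairing measure exactly the change of the term at \<open>v\<close>, so no independence
    of the base point has to be shown.\<close>
  obtain P where "P \<in> adelic_points K V D" using assms(7) by blast
  then obtain P1 where P1: "P1 \<in> adelic_points K V D" "component V D P1 v = P0"
    using replace_component[OF V str D v _ P0] by metis
  \<comment> \<open>An element of \<open>B\<close> is a coset, so a representative has to be chosen;
    the next fact shows that every representative gives the same value, by well-definedness of the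
    sum modulo constant classes.\<close>
  define \<psi> where "\<psi> \<beta> = inv\<^bsub>QZ\<^esub> ?S (SOME \<A>. \<A> \<in> \<beta>) P1" for \<beta>
  have \<psi>: "\<psi> \<beta> = inv\<^bsub>QZ\<^esub> ?S \<A> P1" if "\<beta> \<in> B" "\<A> \<in> \<beta>" for \<beta> \<A>
  proof -
    have "(SOME \<A>. \<A> \<in> \<beta>) \<in> \<beta>" using that(2) by (rule someI)
    moreover have "\<forall>\<beta> \<in> carrier ?G. \<forall>\<A> \<in> \<beta>. \<forall>\<A>' \<in> \<beta>. ?S \<A> P1 = ?S \<A>' P1"
      using assms(6)[unfolded inv_sum_well_defined_def, THEN bspec, OF P1(1)] by (rule conjunct2)
    ultimately have "?S (SOME \<A>. \<A> \<in> \<beta>) P1 = ?S \<A> P1"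
      using BG[OF that(1)] that(2) by blast
    then show ?thesis by (simp only: \<psi>_def)
  qed
  have S_closed: "?S \<A> P1 \<in> carrier QZ" if "\<A> \<in> carrier (Br I V)" for \<A>
    by (rule inv_sum_closed) (rule closed[OF P1(1) _ that])
  have \<psi>_hom: "\<psi> \<in> hom (?G\<lparr>carrier := B\<rparr>) QZ"
  proof (rule homI, simp_all)
    fix \<beta> assume \<beta>: "\<beta> \<in> B"
    obtain \<A> where \<A>: "\<A> \<in> \<beta>" using Br_mod_const_subset(2)[OF Vf I str BG[OF \<beta>]] by blast
    show "\<psi> \<beta> \<in> carrier QZ" using \<psi>[OF \<beta> \<A>] S_closed[OF rep[OF \<beta> \<A>]] by simp
    fix \<gamma> assume \<gamma>: "\<gamma> \<in> B"
    obtain \<C> where \<C>: "\<C> \<in> \<gamma>" using Br_mod_const_subset(2)[OF Vf I str BG[OF \<gamma>]] by blast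
    note rA = rep[OF \<beta> \<A>] and rC = rep[OF \<gamma> \<C>]
    \<comment> \<open>The product of cosets contains the products of representatives, so additivity
      of the sum on \<open>Br I V\<close> passes to the quotient.\<close>
    have "\<A> \<otimes>\<^bsub>Br I V\<^esub> \<C> \<in> \<beta> \<otimes>\<^bsub>?G\<^esub> \<gamma>"
      using \<A> \<C> by (auto simp: Br_mod_const_def FactGroup_def set_mult_def)
    then have "\<psi> (\<beta> \<otimes>\<^bsub>?G\<^esub> \<gamma>) = inv\<^bsub>QZ\<^esub> ?S (\<A> \<otimes>\<^bsub>Br I V\<^esub> \<C>) P1"
      using \<psi>[OF subgroup.m_closed[OF assms(8) \<beta> \<gamma>]] by blast
    also have "?S (\<A> \<otimes>\<^bsub>Br I V\<^esub> \<C>) P1 = ?S \<A> P1 \<otimes>\<^bsub>QZ\<^esub> ?S \<C> P1"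
      by (rule inv_sum_mult[OF hom[OF P1(1)] fin[OF P1(1)] rA rC Br.m_closed[OF rA rC]])
    finally show "\<psi> (\<beta> \<otimes>\<^bsub>?G\<^esub> \<gamma>) = \<psi> \<beta> \<otimes>\<^bsub>QZ\<^esub> \<psi> \<gamma>"
      using S_closed[OF rA] S_closed[OF rC] \<psi>[OF \<beta> \<A>] \<psi>[OF \<gamma> \<C>] by (simp add: QZ.inv_mult)
  qed
  obtain Q where Q: "Q \<in> local_points V D v"
    and Q\<psi>: "\<forall>\<beta> \<in> B. \<forall>\<A> \<in> \<beta>.
      local_inv_at I V D iv v \<A> Q \<otimes>\<^bsub>QZ\<^esub> inv\<^bsub>QZ\<^esub> (local_inv_at I V D iv v \<A> P0) = \<psi> \<beta>"
    using bspec[OF prol \<psi>_hom] by (elim bexE)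
  obtain P2 where P2: "P2 \<in> adelic_points K V D" "component V D P2 v = Q"
    "\<And>w. w \<in> places K \<Longrightarrow> w \<noteq> v \<Longrightarrow> component V D P2 w = component V D P1 w"
    using replace_component[OF V str D v P1(1) Q] by metis
  have "?S \<A> P2 = \<one>\<^bsub>QZ\<^esub>" if "\<beta> \<in> B" "\<A> \<in> \<beta>" for \<beta> \<A>
  proof -
    note rA = rep[OF that]
    \<comment> \<open>Passing from \<open>P1\<close> to \<open>P2\<close> changes the sum by the
      difference of the terms at \<open>v\<close>, which by the choice of \<open>Q\<close> is the
      inverse of the sum at \<open>P1\<close>.\<close>
    have "?S \<A> P2 = ?S \<A> P1 \<otimes>\<^bsub>QZ\<^esub> \<psi> \<beta>"
      using inv_sum_replace_component[OF closed[OF P1(1) _ rA] closed[OF P2(1) _ rA]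
          fin[OF P1(1) rA] fin[OF P2(1) rA] v P2(3)]
      by (simp add: P1(2) P2(2) bspec[OF bspec[OF Q\<psi> that(1)] that(2)])
    then show ?thesis using \<psi>[OF that] S_closed[OF rA] by simp
  qed
  then show ?thesis using P2(1) unfolding brauer_manin_obstruction_def by blast
qed

end
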